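(* There exists a (commutative) Noetherian local ring that is weakly quasi-complete but not quasi-complete.
   Context: Let $(R,\mathfrak m)$ be a Noetherian local ring. $R$ is quasi-complete if for every decreasing sequence $I_1\supseteq I_2\supseteq\cdots$ of ideals of $R$ and every natural number $k$ there exists an index $s_k$ with $I_{s_k}\subseteq\bigl(\bigcap_{n=1}^\infty I_n\bigr)+\mathfrak m^k$. $R$ is weakly quasi-complete if this condition holds for every decreasing sequence of ideals with $\bigcap_{n=1}^\infty I_n=(0)$; that is, for every such sequence and every $k$ there is $s_k$ with $I_{s_k}\subseteq\mathfrak m^k$. *)

theory Defs
  imports "HOL-Algebra.Algebra"
begin

text \<open>
  A Noetherian local ring is a pair of a commutative Noetherian ring and its unique maximal ideal.
\<close>

locale noetherian_local_ring = cring R + noetherian_ring R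
  for R (structure) and \<mm> +
  assumes maximal: "maximalideal \<mm> R"
    and maximal_unique: "maximalideal J R \<Longrightarrow> J = \<mm>"

text \<open>
  Powers of an ideal are taken in the multiplicative monoid of ideals, whose unit is
  \<^term>\<open>carrier R\<close> and whose multiplication is \<^const>\<open>ideal_prod\<close>.
\<close>

abbreviation ideal_power :: "('a, 'b) ring_scheme \<Rightarrow> 'a set \<Rightarrow> nat \<Rightarrow> 'a set"
  where "ideal_power R I k \<equiv> I [^]\<^bsub>ideals_set R\<^esub> k"

text \<open>
  Decreasing sequences of ideals are indexed from \<open>0\<close>. The argument \<open>\<mm>\<close> is meant to be
  the maximal ideal of \<open>R\<close>.
\<close>

definition quasi_complete :: "('a, 'b) ring_scheme \<Rightarrow> 'a set \<Rightarrow> bool"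
  where "quasi_complete R \<mm> \<longleftrightarrow>
    (\<forall>I :: nat \<Rightarrow> 'a set. (\<forall>n. ideal (I n) R) \<longrightarrow> decseq I \<longrightarrow>
      (\<forall>k. \<exists>s. I s \<subseteq> (\<Inter>n. I n) <+>\<^bsub>R\<^esub> ideal_power R \<mm> k))"

definition weakly_quasi_complete :: "('a, 'b) ring_scheme \<Rightarrow> 'a set \<Rightarrow> bool"
  where "weakly_quasi_complete R \<mm> \<longleftrightarrow>
    (\<forall>I :: nat \<Rightarrow> 'a set. (\<forall>n. ideal (I n) R) \<longrightarrow> decseq I \<longrightarrow> (\<Inter>n. I n) = {\<zero>\<^bsub>R\<^esub>} \<longrightarrow>
      (\<forall>k. \<exists>s. I s \<subseteq> ideal_power R \<mm> k))"

end

theory Submission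
  imports
    Defs
    "HOL-Computational_Algebra.Formal_Power_Series"
    "HOL-Computational_Algebra.Fraction_Field"
    "HOL-Library.Poly_Mapping"
    "HOL-Library.Z2"
    "HOL-Library.Countable_Set"
begin

unbundle fps_syntax

text \<open>
  Let \<open>k\<close> be a field of characteristic two that is the union of an increasing chain of proper
  subfields \<open>K\<^sub>0 \<subseteq> K\<^sub>1 \<subseteq> \<dots>\<close>, each of which contains all squares of \<open>k\<close>, and put
  \<open>T = k[[x,y]]\<close>. The example is Nagata's ring \<open>R = \<Union>\<^sub>i K\<^sub>i[[x,y]]\<close>, whose completion is \<open>T\<close>.

  \<^bold>\<open>Noetherian.\<close> Choose finitely many elements of an ideal \<open>I\<close> of \<open>R\<close> whose leading monomials
  generate those of \<open>I\<close> under divisibility (Dickson). Any \<open>f \<in> R\<close> in the adic closure of \<open>I\<close> lies,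
  together with these elements, in one \<open>K\<^sub>i[[x,y]]\<close>, and division by leading terms never leaves that
  ring. Hence \<open>f\<close> is a combination of the chosen elements with coefficients in \<open>R\<close>. So \<open>I\<close> is
  finitely generated and, at the same time, closed (\<open>standard_basis\<close>, \<open>ideal_closed\<close>).

  \<^bold>\<open>Weakly quasi-complete.\<close> If no member of a decreasing sequence \<open>I\<^sub>n\<close> lies in \<open>\<mm>\<^sup>k\<close>, then some
  monomial of degree below \<open>k\<close> occurs with coefficient \<open>1\<close> in an element of every \<open>I\<^sub>n\<close>. Such
  elements form affine subspaces, so by linear compactness (\<open>affine_sequence_limit\<close>) there is a
  \<open>g \<noteq> 0\<close> in \<open>T\<close> that lies in the closure of every \<open>I\<^sub>n\<close>. In general \<open>g\<close> is not in \<open>R\<close>, but \<open>g\<^sup>2\<close> is,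
  because its coefficients are squares in \<open>k\<close>. It lies in the closure of every \<open>I\<^sub>n\<close>, hence in every
  \<open>I\<^sub>n\<close>, and so the intersection of the \<open>I\<^sub>n\<close> is not zero.

  \<^bold>\<open>Not quasi-complete.\<close> Let \<open>c \<in> x k[[x]]\<close> have its coefficients in no \<open>K\<^sub>i\<close>, and let \<open>u = y - c\<close>.
  If \<open>u h \<in> R\<close> with \<open>h\<close> a unit of \<open>T\<close>, then solving \<open>u h = 0\<close> for \<open>y\<close> would put \<open>c\<close> into
  some \<open>K\<^sub>i[[x]]\<close> (\<open>cofactor_of_branch_not_unit\<close>); hence \<open>u T \<inter> R\<close> contains only series without
  terms of degree below two. The ideals of those \<open>f \<in> R\<close> that are close to \<open>u T\<close> decrease to
  \<open>u T \<inter> R\<close>, but each of them contains some \<open>y - c\<^sub>s\<close> with a truncation \<open>c\<^sub>s\<close> of \<open>c\<close>, and no such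
  element lies in \<open>(u T \<inter> R) + \<mm>\<^sup>2\<close>.

  For \<open>k\<close> one can take the field of rational functions over \<open>F\<^sub>2\<close> in countably many variables. It is
  countable, so \<open>R\<close> embeds into the subsets of \<open>\<nat>\<close>, and its structure is transported along the
  embedding.
\<close>

section \<open>Subfields\<close>

definition subfield_set :: "'k::field set \<Rightarrow> bool"
  where "subfield_set K \<longleftrightarrow> 1 \<in> K \<and> (\<forall>a\<in>K. \<forall>b\<in>K. a - b \<in> K \<and> a * b \<in> K) \<and> (\<forall>a\<in>K. inverse a \<in> K)"

text \<open>
  The subfields have to contain the squares for the squares of all series to have coefficients in
  one of them, and to be proper for a series to exist whose coefficients lie in none of them.
\<close>
locale square_subfield_chain =
  fixes K :: "nat \<Rightarrow> 'k::field set"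
  assumes subfield_chain: "subfield_set (K i)"
    and mono_chain: "mono K"
    and exhaust_chain: "\<exists>i. a \<in> K i"
    and proper_chain: "K i \<noteq> UNIV"
    and squares_chain: "a * a \<in> K i"
    and char_two: "(1::'k) + 1 = 0"

lemma subfield_set_UNIV: "subfield_set UNIV" by (simp add: subfield_set_def)

lemma subfield_setD:
  assumes "subfield_set K"
  shows "1 \<in> K" "0 \<in> K" "a \<in> K \<Longrightarrow> b \<in> K \<Longrightarrow> a - b \<in> K" "a \<in> K \<Longrightarrow> - a \<in> K"
    "a \<in> K \<Longrightarrow> b \<in> K \<Longrightarrow> a + b \<in> K" "a \<in> K \<Longrightarrow> b \<in> K \<Longrightarrow> a * b \<in> K"
    "a \<in> K \<Longrightarrow> inverse a \<in> K" "a \<in> K \<Longrightarrow> b \<in> K \<Longrightarrow> a / b \<in> K"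
proof -
  show 1: "1 \<in> K" using assms unfolding subfield_set_def by blast
  show d: "a - b \<in> K" if "a \<in> K" "b \<in> K" for a b using that assms unfolding subfield_set_def by blast
  show 0: "0 \<in> K" using d[of 1 1] 1 assms unfolding subfield_set_def by simp
  show m: "- a \<in> K" if "a \<in> K" for a using d[of 0 a] 0 that by simp
  show "a + b \<in> K" if "a \<in> K" "b \<in> K" for a b using d[of a "-b"] m that by simp
  show mu: "a * b \<in> K" if "a \<in> K" "b \<in> K" for a b using that assms unfolding subfield_set_def by blast
  show i: "inverse a \<in> K" if "a \<in> K" for a using that assms unfolding subfield_set_def by blast
  show "a / b \<in> K" if "a \<in> K" "b \<in> K" for a b using that mu i by (simp add: divide_inverse)
qed

lemma subfield_set_sum: "subfield_set K \<Longrightarrow> (\<And>i. i \<in> I \<Longrightarrow> f i \<in> K) \<Longrightarrow> sum f I \<in> K"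
  by (induction I rule: infinite_finite_induct) (auto simp: subfield_setD)

section \<open>A field of characteristic two that is infinite over its squares\<close>

type_synonym f2_poly = "(nat \<Rightarrow>\<^sub>0 nat) \<Rightarrow>\<^sub>0 bit"

text \<open>
  These are the polynomials over the field of squares (that is, with all exponents even) in the
  variables of index at least \<open>i\<close>, and arbitrary ones in the variables before.
\<close>
definition even_from :: "nat \<Rightarrow> f2_poly set"
  where "even_from i = {p. \<forall>e\<in>Poly_Mapping.keys p. \<forall>j\<ge>i. even (Poly_Mapping.lookup e j)}"

lemma f2_poly_char_two: "(p::f2_poly) + p = 0"
proof (rule poly_mapping_eqI)
  fix e show "Poly_Mapping.lookup (p + p) e = Poly_Mapping.lookup 0 e"
    by (cases "Poly_Mapping.lookup p e") (simp_all only: lookup_add lookup_zero, simp_all)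
qed

lemma even_from_add: "p \<in> even_from i \<Longrightarrow> q \<in> even_from i \<Longrightarrow> p + q \<in> even_from i"
  using Poly_Mapping.keys_add[of p q] unfolding even_from_def by blast

lemma even_from_mult:
  assumes "p \<in> even_from i" "q \<in> even_from i" shows "p * q \<in> even_from i"
  unfolding even_from_def
proof (intro CollectI ballI allI impI)
  fix e j assume "e \<in> Poly_Mapping.keys (p * q)" "i \<le> j"
  then obtain a b where "e = a + b" "a \<in> Poly_Mapping.keys p" "b \<in> Poly_Mapping.keys q" using keys_mult[of p q] by blast
  then show "even (Poly_Mapping.lookup e j)" using assms \<open>i \<le> j\<close> unfolding even_from_def by (auto simp: lookup_add)
qed

lemma even_from_mono: "i \<le> j \<Longrightarrow> even_from i \<subseteq> even_from j"
  unfolding even_from_def by auto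

text \<open>
  The mixed terms of a square occur twice and cancel.
\<close>
lemma even_from_square: "p * p \<in> even_from i"
proof (induction p rule: update_induct)
  case const
  then show ?case by (simp add: even_from_def)
next
  case (update f k v)
  define s where "s = Poly_Mapping.single k v"
  have "Poly_Mapping.update k v f = s + f"
    using update(1) by (intro poly_mapping_eqI) (auto simp: s_def lookup_update lookup_add lookup_single in_keys_iff when_def)
  then have "Poly_Mapping.update k v f * Poly_Mapping.update k v f = s * s + f * f + (s * f + s * f)"
    by (simp add: algebra_simps)
  moreover have "s * s \<in> even_from i"
    by (auto simp: s_def Poly_Mapping.mult_single even_from_def lookup_add split: if_splits)
  ultimately show ?case using update even_from_add by (simp add: f2_poly_char_two)
qed

lemma even_from_exhaust: "\<exists>i. p \<in> even_from i"
proof -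
  have "finite (\<Union>e\<in>Poly_Mapping.keys p. Poly_Mapping.keys e)" by simp
  then obtain i where i: "\<forall>j\<in>(\<Union>e\<in>Poly_Mapping.keys p. Poly_Mapping.keys e). j < i"
    by (meson finite_nat_set_iff_bounded)
  have "Poly_Mapping.lookup e j = 0" if "e \<in> Poly_Mapping.keys p" "i \<le> j" for e j
  proof -
    have "j \<notin> Poly_Mapping.keys e" using i that by (meson UN_I leD)
    then show ?thesis by (simp only: not_in_keys_iff_lookup_eq_zero)
  qed
  then have "p \<in> even_from i" unfolding even_from_def by simp
  then show ?thesis ..
qed

definition variable :: "nat \<Rightarrow> f2_poly" where "variable i = Poly_Mapping.single (Poly_Mapping.single i 1) 1"

lemma lookup_single_mult_shift:
  fixes p :: "'a::cancel_comm_monoid_add \<Rightarrow>\<^sub>0 'b::comm_semiring_1"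
  shows "Poly_Mapping.lookup (Poly_Mapping.single a 1 * p) (a + e) = Poly_Mapping.lookup p e"
  by (simp add: lookup_mult lookup_single when_mult)

text \<open>
  Multiplication by the \<open>i\<close>-th variable turns its even exponents into odd ones. This is what keeps
  that variable out of the \<open>i\<close>-th subfield.
\<close>
lemma variable_times_even_from:
  assumes "p \<in> even_from i" "variable i * p \<in> even_from i" shows "p = 0"
proof (rule poly_mapping_eqI, rule ccontr)
  fix e assume "Poly_Mapping.lookup p e \<noteq> Poly_Mapping.lookup 0 e"
  then have e: "e \<in> Poly_Mapping.keys p" by (simp add: in_keys_iff)
  have "Poly_Mapping.lookup (variable i * p) (Poly_Mapping.single i 1 + e) = Poly_Mapping.lookup p e"
    unfolding variable_def by (rule lookup_single_mult_shift)
  then have "Poly_Mapping.single i 1 + e \<in> Poly_Mapping.keys (variable i * p)" using e by (simp add: in_keys_iff)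
  then have "even (Poly_Mapping.lookup (Poly_Mapping.single i 1 + e) i)" "even (Poly_Mapping.lookup e i)" 
    using assms e unfolding even_from_def by blast+
  then show False by (simp add: lookup_add lookup_single)
qed

lemma one_even_from: "1 \<in> even_from i" using even_from_square[of 1] by simp

text \<open>
  Square denominators lose no generality, since \<open>a / b = a b / b\<^sup>2\<close>, and they make a fraction belong
  to the subfield as soon as its numerator does.
\<close>
definition even_chain :: "nat \<Rightarrow> f2_poly fract set"
  where "even_chain i = {Fraction_Field.Fract a (b * b) |a b. a \<in> even_from i \<and> b \<noteq> 0}"

text \<open>
  A finitely supported function is determined by its finite graph over its support.
\<close>
lemma countable_poly_mapping: "countable (UNIV :: ('a::countable \<Rightarrow>\<^sub>0 'b::{countable,zero}) set)"
proof -
  let ?g = "\<lambda>p. (\<lambda>x. (x, Poly_Mapping.lookup p x)) ` Poly_Mapping.keys p"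
  have "inj (?g :: ('a \<Rightarrow>\<^sub>0 'b) \<Rightarrow> _)"
  proof (rule injI, rule poly_mapping_eqI)
    fix p q :: "'a \<Rightarrow>\<^sub>0 'b" and x assume eq: "?g p = ?g q"
    have "(x, y) \<in> ?g p \<longleftrightarrow> Poly_Mapping.lookup p x = y \<and> y \<noteq> 0" for y and p :: "'a \<Rightarrow>\<^sub>0 'b" by (auto simp: in_keys_iff)
    then show "Poly_Mapping.lookup p x = Poly_Mapping.lookup q x" using eq by metis
  qed
  moreover have "countable (range (?g :: ('a \<Rightarrow>\<^sub>0 'b) \<Rightarrow> _))"
    by (rule countable_subset[OF _ countable_Collect_finite]) auto
  ultimately show ?thesis using countable_image_inj_on by blast
qed

instance poly_mapping :: (countable, "{countable,zero}") countable
proof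
  show "\<exists>f :: ('a \<Rightarrow>\<^sub>0 'b) \<Rightarrow> nat. inj f" using countable_poly_mapping unfolding countable_def by blast
qed

instance bit :: finite
proof
  have "(UNIV :: bit set) = {0, 1}" by (auto simp: bit_not_one_iff)
  then show "finite (UNIV :: bit set)" by (metis finite.simps)
qed

lemma fract_char_two: "(x :: f2_poly fract) + x = 0"
proof -
  obtain a b where x: "x = Fraction_Field.Fract a b" and "b \<noteq> 0" by (cases x)
  have "x + x = Fraction_Field.Fract (a * b + a * b) (b * b)"
    unfolding x by (rule add_fract) (fact \<open>b \<noteq> 0\<close>)+
  then show ?thesis by (simp only: f2_poly_char_two fract_collapse)
qed

lemma subfield_set_even_chain: "subfield_set (even_chain i)"
  unfolding subfield_set_def
proof (intro conjI ballI)
  show "1 \<in> even_chain i" unfolding even_chain_def One_fract_def using one_even_from[of i] by (intro CollectI exI[of _ 1]) simp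
  fix x y assume "x \<in> even_chain i" "y \<in> even_chain i"
  then obtain a b c d where x: "x = Fraction_Field.Fract a (b*b)" "a \<in> even_from i" "b \<noteq> 0"
    and y: "y = Fraction_Field.Fract c (d*d)" "c \<in> even_from i" "d \<noteq> 0" unfolding even_chain_def by blast
  have "x - y = x + y" using fract_char_two[of y] by (metis diff_conv_add_uminus eq_neg_iff_add_eq_0)
  then have "x - y = Fraction_Field.Fract (a * (d*d) + c * (b*b)) ((b*d)*(b*d))"
    using x y by (simp add: mult_ac)
  moreover have "a * (d*d) + c * (b*b) \<in> even_from i" "b * d \<noteq> 0"
    using x y by (simp_all add: even_from_add even_from_mult even_from_square)
  ultimately show "x - y \<in> even_chain i" unfolding even_chain_def by blast
  have "x * y = Fraction_Field.Fract (a * c) ((b*d)*(b*d))" using x y by (simp add: mult_ac)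
  moreover have "a * c \<in> even_from i" "b * d \<noteq> 0" using x y by (simp_all add: even_from_mult)
  ultimately show "x * y \<in> even_chain i" unfolding even_chain_def by blast
next
  fix x assume "x \<in> even_chain i"
  then obtain a b where x: "x = Fraction_Field.Fract a (b*b)" "a \<in> even_from i" "b \<noteq> 0" unfolding even_chain_def by blast
  show "inverse x \<in> even_chain i"
  proof (cases "a = 0")
    case True
    then have "inverse x = x" using x by (simp add: fract_collapse)
    then show ?thesis using \<open>x \<in> even_chain i\<close> by simp
  next
    case False
    then have "inverse x = Fraction_Field.Fract (a * (b*b)) (a * a)" using x by (simp add: eq_fract mult_ac)
    then show ?thesis unfolding even_chain_def using x False even_from_mult even_from_square by blast
  qed
qed

lemma square_subfield_chain_even_chain: "square_subfield_chain even_chain"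
proof
  show "subfield_set (even_chain i)" for i by (rule subfield_set_even_chain)
  show "mono even_chain" unfolding mono_def even_chain_def using even_from_mono by blast
  fix x :: "f2_poly fract" and i
  obtain a b where x: "x = Fraction_Field.Fract a b" "b \<noteq> 0" by (cases x)
  obtain j where "a * b \<in> even_from j" using even_from_exhaust by blast
  moreover have "x = Fraction_Field.Fract (a*b) (b*b)" using x by (simp add: eq_fract mult_ac)
  ultimately have "x \<in> even_chain j" unfolding even_chain_def using x by blast
  then show "\<exists>i. x \<in> even_chain i" by blast
  have "x * x = Fraction_Field.Fract (a*a) (b*b)" using x by simp
  then show "x * x \<in> even_chain i" unfolding even_chain_def using x even_from_square by blast
  show "(1::f2_poly fract) + 1 = 0" by (rule fract_char_two)
  have "Fraction_Field.Fract (variable i) 1 \<notin> even_chain i"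
  proof
    assume "Fraction_Field.Fract (variable i) 1 \<in> even_chain i"
    then obtain a b where "Fraction_Field.Fract (variable i) 1 = Fraction_Field.Fract a (b*b)" "a \<in> even_from i" "b \<noteq> 0"
      unfolding even_chain_def by blast
    then show False using variable_times_even_from[of "b*b" i] even_from_square[of b] by (simp add: eq_fract)
  qed
  then show "even_chain i \<noteq> UNIV" by blast
qed

lemma countable_fract: "countable (UNIV :: f2_poly fract set)"
proof -
  have "countable (range (\<lambda>(a::f2_poly,b). Fraction_Field.Fract a b))"
    by (rule countable_image[OF countableI_type])
  moreover have "surj (\<lambda>(a::f2_poly,b). Fraction_Field.Fract a b)"
    unfolding surj_def
  proof
    fix x :: "f2_poly fract"
    obtain a b where "x = Fraction_Field.Fract a b" by (cases x)
    then have "x = (\<lambda>(a, b). Fraction_Field.Fract a b) (a, b)" by (simp only: prod.case)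
    then show "\<exists>y. x = (\<lambda>(a::f2_poly,b). Fraction_Field.Fract a b) y" ..
  qed
  ultimately show ?thesis by (simp only:)
qed

section \<open>Linear compactness\<close>

text \<open>
  The limit is built one coordinate at a time. The values that remain possible at the next coordinate
  form a decreasing sequence of nonempty affine subsets of the line \<open>K\<close>. Each of them is a single
  point or all of \<open>K\<close>, so they have a common element, and any such element extends \<open>g\<close>. In the product
  topology, \<open>g\<close> is a common limit point of the affine spaces \<open>A n\<close>.
\<close>
lemma affine_sequence_limit:
  fixes A :: "nat \<Rightarrow> ('i::countable \<Rightarrow> 'k::field) set"
  assumes K: "subfield_set K"
    and dec: "decseq A"
    and ne: "\<And>n. A n \<noteq> {}"
    and vals: "\<And>n a i. a \<in> A n \<Longrightarrow> a i \<in> K"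
    and affine: "\<And>n a b t. a \<in> A n \<Longrightarrow> b \<in> A n \<Longrightarrow> t \<in> K \<Longrightarrow> (\<lambda>i. a i + t * (b i - a i)) \<in> A n"
  obtains g where "\<And>i. g i \<in> K" "\<And>n F. finite F \<Longrightarrow> \<exists>a\<in>A n. \<forall>i\<in>F. a i = g i"
proof -
  \<comment> \<open>The first \<open>j\<close> values of \<open>g\<close> extend to an element of every \<open>A n\<close>.\<close>
  define ok where "ok g j \<longleftrightarrow> (\<forall>n. \<exists>a\<in>A n. \<forall>i. to_nat i < j \<longrightarrow> a i = g (to_nat i))" for g j
  have step: "\<exists>v. ok (g(j := v)) (Suc j)" if okg: "ok g j" for g j
  proof (cases "j \<in> range (to_nat :: 'i \<Rightarrow> nat)")
    case False
    have "ok (g(j := 0)) (Suc j)" unfolding ok_def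
    proof
      fix n 
      obtain a where "a \<in> A n" "\<forall>i. to_nat i < j \<longrightarrow> a i = g (to_nat i)" using okg unfolding ok_def by blast
      then show "\<exists>a\<in>A n. \<forall>i. to_nat i < Suc j \<longrightarrow> a i = (g(j := 0)) (to_nat i)"
        using False by (intro bexI[of _ a]) (auto simp: less_Suc_eq)
    qed
    then show ?thesis ..
  next
    case True
    then obtain i0 :: 'i where i0: "j = to_nat i0" by blast
    define B where "B n = {a\<in>A n. \<forall>i. to_nat i < j \<longrightarrow> a i = g (to_nat i)}" for n
    have Bne: "B n \<noteq> {}" for n using okg unfolding ok_def B_def by blast
    have Bdec: "B n \<subseteq> B m" if "m \<le> n" for m n using dec that unfolding B_def decseq_def by blast
    define E where "E n = (\<lambda>a. a i0) ` B n" for n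
    have EK: "E n \<subseteq> K" for n using vals unfolding E_def B_def by blast
    \<comment> \<open>An affine subset of the line \<open>K\<close> with two points is the whole line.\<close>
    have full: "E n = K" if xy: "x \<in> E n" "y \<in> E n" "x \<noteq> y" for n x y
    proof
      show "K \<subseteq> E n"
      proof
        fix z assume "z \<in> K"
        obtain a b where a: "a \<in> B n" "x = a i0" and b: "b \<in> B n" "y = b i0" using xy unfolding E_def by blast
        define t where "t = (z - x) / (y - x)"
        have "x \<in> K" "y \<in> K" using xy EK by blast+
        then have "t \<in> K" unfolding t_def using \<open>z \<in> K\<close> K by (intro subfield_setD)
        then have "(\<lambda>i. a i + t * (b i - a i)) \<in> B n" using a b affine unfolding B_def by simp
        moreover have "a i0 + t * (b i0 - a i0) = z" using xy a b by (simp add: t_def)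
        ultimately show "z \<in> E n" unfolding E_def by force
      qed
    qed (rule EK)
    have "\<exists>v. \<forall>n. v \<in> E n"
    proof (cases "\<exists>m v. E m = {v}")
      case True
      then obtain m v where mv: "E m = {v}" by blast
      have "v \<in> E n" for n
      proof -
        have "E (max m n) \<subseteq> E m" "E (max m n) \<subseteq> E n" unfolding E_def by (intro image_mono Bdec; simp)+
        moreover have "E (max m n) \<noteq> {}" using Bne unfolding E_def by blast
        ultimately show ?thesis using mv by (metis insert_subset subset_singletonD)
      qed
      then show ?thesis by blast
    next
      case False
      have "E n = K" for n
      proof -
        obtain x where x: "x \<in> E n" using Bne[of n] unfolding E_def by blast
        moreover obtain y where "y \<in> E n" "y \<noteq> x" using False x by blast
        ultimately show ?thesis using full by blast
      qed
      then show ?thesis using subfield_setD(1)[OF K] by blast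
    qed
    then obtain v where v: "\<And>n. v \<in> E n" by blast
    have "ok (g(j := v)) (Suc j)" unfolding ok_def
    proof
      fix n
      obtain a where a: "a \<in> B n" "v = a i0" using v[of n] unfolding E_def by blast
      then show "\<exists>a\<in>A n. \<forall>i. to_nat i < Suc j \<longrightarrow> a i = (g(j := v)) (to_nat i)"
        using i0 unfolding B_def by (intro bexI[of _ a]) (auto simp: less_Suc_eq)
    qed
    then show ?thesis ..
  qed
  define G where "G = rec_nat (\<lambda>_. 0 :: 'k) (\<lambda>j g. g(j := (SOME v. ok (g(j := v)) (Suc j))))"
  have G_Suc: "G (Suc j) = (G j)(j := (SOME v. ok ((G j)(j := v)) (Suc j)))" for j by (simp add: G_def)
  have okG: "ok (G j) j" for j
  proof (induction j)
    case 0 then show ?case unfolding ok_def using ne by auto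
  next
    case (Suc j) then show ?case unfolding G_Suc by (rule someI_ex[OF step])
  qed
  have stable: "G j i = G (Suc i) i" if "i < j" for i j
    using that by (induction j) (auto simp: G_Suc less_Suc_eq)
  define g where "g i = G (Suc (to_nat i)) (to_nat i)" for i :: 'i
  have fin: "\<exists>a\<in>A n. \<forall>i\<in>F. a i = g i" if "finite F" for n F
  proof -
    obtain j where j: "\<forall>i\<in>to_nat ` F. i < j" using \<open>finite F\<close> by (meson finite_imageI finite_nat_set_iff_bounded)
    obtain a where "a \<in> A n" "\<forall>i. to_nat i < j \<longrightarrow> a i = G j (to_nat i)" using okG[of j] unfolding ok_def by blast
    moreover have "a i = g i" if "i \<in> F" for i
      using calculation(2) j stable[of "to_nat i" j] that unfolding g_def by simp
    ultimately show ?thesis by blast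
  qed
  show thesis
  proof (rule that)
    fix i
    obtain a where "a \<in> A 0" "a i = g i" using fin[of "{i}" 0] by auto
    then show "g i \<in> K" by (metis vals)
  qed (rule fin)
qed

section \<open>Monomials and power series in two variables\<close>

text \<open>
  Fix one element \<open>(a, b)\<close> of \<open>L\<close>. The elements that are not above it lie in finitely many rows and
  columns, and a row or a column needs only its least element.
\<close>
lemma dickson_pairs:
  fixes L :: "(nat \<times> nat) set"
  obtains F where "finite F" "F \<subseteq> L" "\<And>n m. (n, m) \<in> L \<Longrightarrow> \<exists>(n', m')\<in>F. n' \<le> n \<and> m' \<le> m"
proof (cases "L = {}")
  case True then show ?thesis using that[of "{}"] by blast
next
  case False
  then obtain a b where ab: "(a, b) \<in> L" by force
  define row where "row n = (n, LEAST m. (n, m) \<in> L)" for n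
  define col where "col m = (LEAST n. (n, m) \<in> L, m)" for m
  define F where "F = insert (a, b) ((row ` {..<a} \<union> col ` {..<b}) \<inter> L)"
  show ?thesis
  proof (rule that)
    show "finite F" "F \<subseteq> L" unfolding F_def using ab by auto
    fix n m assume nm: "(n, m) \<in> L"
    consider "a \<le> n" "b \<le> m" | "n < a" | "m < b" by linarith
    then show "\<exists>(n', m')\<in>F. n' \<le> n \<and> m' \<le> m"
    proof cases
      case 1 then show ?thesis unfolding F_def by blast
    next
      case 2
      have "row n \<in> L" unfolding row_def using nm by (metis LeastI)
      then have "row n \<in> F" unfolding F_def using 2 by blast
      then show ?thesis unfolding row_def using Least_le[of "\<lambda>m. (n, m) \<in> L", OF nm] by force
    next
      case 3
      have "col m \<in> L" unfolding col_def using nm by (metis (mono_tags, lifting) LeastI)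
      then have "col m \<in> F" unfolding F_def using 3 by blast
      then show ?thesis unfolding col_def using Least_le[of "\<lambda>n. (n, m) \<in> L", OF nm] by force
    qed
  qed
qed

lemma mono_triangle: "m \<le> n \<Longrightarrow> triangle m \<le> triangle n"
  by (induction rule: dec_induct) auto

text \<open>
  The pairing function enumerates the exponent pairs by total degree first. It is a monomial order of
  order type \<open>\<omega>\<close>: it is compatible with multiplication of monomials, and its initial segments are
  finite and cofinal with the powers of the maximal ideal.
\<close>
lemma prod_encode_less_iff:
  "prod_encode (a, b) < prod_encode (c, d) \<longleftrightarrow> a + b < c + d \<or> (a + b = c + d \<and> a < c)"
proof -
  have *: "prod_encode (a, b) < prod_encode (c, d)" if "a + b < c + d" for a b c d
  proof -
    have "prod_encode (a, b) < triangle (Suc (a + b))" by (simp add: prod_encode_def)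
    also have "\<dots> \<le> triangle (c + d)" using that by (intro mono_triangle) simp
    also have "\<dots> \<le> prod_encode (c, d)" by (simp add: prod_encode_def)
    finally show ?thesis .
  qed
  consider "a + b < c + d" | "c + d < a + b" | "a + b = c + d" by linarith
  then show ?thesis using *[of a b c d] *[of c d a b]
    by cases (auto simp: prod_encode_def)
qed

lemma prod_encode_mono: "a \<le> c \<Longrightarrow> b \<le> d \<Longrightarrow> prod_encode (a, b) \<le> prod_encode (c, d)"
  unfolding not_less[symmetric] prod_encode_less_iff by linarith

lemma prod_encode_shift_less_iff:
  "prod_encode (a + p, b + q) < prod_encode (c + p, d + q) \<longleftrightarrow> prod_encode (a, b) < prod_encode (c, d)"
  unfolding prod_encode_less_iff by linarith

lemma prod_encode_ge_triangle_iff: "triangle k \<le> prod_encode (a, b) \<longleftrightarrow> k \<le> a + b"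
proof
  assume "k \<le> a + b"
  then show "triangle k \<le> prod_encode (a, b)" using mono_triangle by (force simp: prod_encode_def)
next
  assume "triangle k \<le> prod_encode (a, b)"
  then have "\<not> prod_encode (a, b) < prod_encode (0, k)" by (simp add: prod_encode_def)
  then show "k \<le> a + b" unfolding prod_encode_less_iff by linarith
qed

text \<open>
  In a series \<open>f\<close> in two variables, \<open>f $ n $ m\<close> is the coefficient of \<open>y\<^sup>n x\<^sup>m\<close>: the outer variable is
  \<open>y\<close>.
\<close>
type_synonym 'k fps2 = "'k fps fps"

definition fps2_over :: "'k::field set \<Rightarrow> 'k fps2 set"
  where "fps2_over K = {f. \<forall>n m. f $ n $ m \<in> K}"

text \<open>
  This filtration refines the one by the powers of the ideal \<open>(x, y)\<close>: one more monomial has to be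
  absent at each step.
\<close>
definition vanishing :: "nat \<Rightarrow> 'k::field fps2 set"
  where "vanishing j = {f. \<forall>n m. prod_encode (n, m) < j \<longrightarrow> f $ n $ m = 0}"

definition leading_at :: "'k::field fps2 \<Rightarrow> nat \<Rightarrow> nat \<Rightarrow> bool"
  where "leading_at f n m \<longleftrightarrow> f \<in> vanishing (prod_encode (n, m)) \<and> f $ n $ m \<noteq> 0"

definition term2 :: "'k::field \<Rightarrow> nat \<Rightarrow> nat \<Rightarrow> 'k fps2"
  where "term2 c n m = fps_X ^ n * fps_const (fps_X ^ m * fps_const c)"

lemma fps2_mult_nth: "((f * g :: 'k::field fps2) $ n) $ m = (\<Sum>i\<le>n. \<Sum>j\<le>m. f $ i $ j * g $ (n - i) $ (m - j))"
  by (simp add: fps_mult_nth fps_sum_nth atLeast0AtMost)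

lemma term2_mult_nth:
  "(term2 c a b * f) $ n $ m = (if a \<le> n \<and> b \<le> m then c * f $ (n - a) $ (m - b) else 0)"
proof -
  have eq: "term2 c a b * f = fps_X ^ a * (fps_const (fps_X ^ b) * (fps_const (fps_const c) * f))"
    unfolding term2_def by (simp only: fps_const_mult[symmetric] mult.assoc)
  show ?thesis unfolding eq by (simp add: fps_X_power_mult_nth)
qed

lemma term2_nth: "term2 c a b $ n $ m = (if n = a \<and> m = b then c else 0)"
  using term2_mult_nth[of c a b 1 n m] by (auto simp: fps_one_nth split: if_splits)

lemma fps2_over_closed:
  assumes K: "subfield_set K"
  shows "0 \<in> fps2_over K" "1 \<in> fps2_over K" 
    "f \<in> fps2_over K \<Longrightarrow> g \<in> fps2_over K \<Longrightarrow> f + g \<in> fps2_over K"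
    "f \<in> fps2_over K \<Longrightarrow> g \<in> fps2_over K \<Longrightarrow> f - g \<in> fps2_over K"
    "f \<in> fps2_over K \<Longrightarrow> g \<in> fps2_over K \<Longrightarrow> f * g \<in> fps2_over K"
    "c \<in> K \<Longrightarrow> term2 c a b \<in> fps2_over K"
  using K by (auto simp: fps2_over_def fps2_mult_nth term2_nth fps_one_nth subfield_setD intro!: subfield_set_sum)

lemma fps2_over_sum: "subfield_set K \<Longrightarrow> (\<And>i. i \<in> I \<Longrightarrow> f i \<in> fps2_over K) \<Longrightarrow> sum f I \<in> fps2_over K"
  by (induction I rule: infinite_finite_induct) (auto simp: fps2_over_closed)

lemma fps2_over_mono: "K \<subseteq> L \<Longrightarrow> fps2_over K \<subseteq> fps2_over L" by (auto simp: fps2_over_def)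

lemma vanishing_closed:
  "0 \<in> vanishing j" 
  "f \<in> vanishing j \<Longrightarrow> g \<in> vanishing j \<Longrightarrow> f + g \<in> vanishing j"
  "f \<in> vanishing j \<Longrightarrow> g \<in> vanishing j \<Longrightarrow> f - g \<in> vanishing j"
  by (auto simp: vanishing_def)

lemma vanishing_mult:
  assumes "f \<in> vanishing j" shows "g * f \<in> vanishing j"
proof -
  have "f $ (n - a) $ (m - b) = 0" if "prod_encode (n, m) < j" for n m a b
    using assms that prod_encode_mono[of "n - a" n "m - b" m] unfolding vanishing_def by simp
  then show ?thesis by (simp add: vanishing_def fps2_mult_nth)
qed

lemma vanishing_sum: "(\<And>i. i \<in> I \<Longrightarrow> f i \<in> vanishing j) \<Longrightarrow> sum f I \<in> vanishing j"
  by (induction I rule: infinite_finite_induct) (auto simp: vanishing_closed)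

lemma vanishing_antimono: "i \<le> j \<Longrightarrow> vanishing j \<subseteq> vanishing i" by (auto simp: vanishing_def)

lemma vanishing_0: "f \<in> vanishing 0" by (simp add: vanishing_def)

lemma vanishing_SucI:
  assumes "f \<in> vanishing (prod_encode (n, m))" "f $ n $ m = 0" shows "f \<in> vanishing (Suc (prod_encode (n, m)))"
  unfolding vanishing_def
proof (intro CollectI allI impI)
  fix a b assume "prod_encode (a, b) < Suc (prod_encode (n, m))"
  then consider "prod_encode (a, b) < prod_encode (n, m)" | "(a, b) = (n, m)" by (metis less_SucE prod_encode_eq)
  then show "f $ a $ b = 0" using assms by cases (auto simp: vanishing_def)
qed

lemma vanishing_all_zero: "(\<And>j. f \<in> vanishing j) \<Longrightarrow> f = 0"
  by (intro fps_ext) (force simp: vanishing_def)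

text \<open>
  Leading monomials do not change under small perturbations, so an ideal and its closure have the same
  ones.
\<close>
lemma leading_at_cong:
  assumes "leading_at f n m" "f - g \<in> vanishing (Suc (prod_encode (n, m)))" shows "leading_at g n m"
proof -
  have "g = f - (f - g)" by simp
  moreover have "f - g \<in> vanishing (prod_encode (n, m))" using assms(2) vanishing_antimono[of "prod_encode (n,m)" "Suc (prod_encode (n, m))"] by auto
  ultimately have "g \<in> vanishing (prod_encode (n, m))" using assms(1) vanishing_closed unfolding leading_at_def by metis
  moreover have "(f - g) $ n $ m = 0" using assms(2) unfolding vanishing_def by blast
  ultimately show ?thesis using assms(1) unfolding leading_at_def by simp
qed

lemma leading_at_reduce:
  assumes f: "leading_at f n m" and s: "leading_at s n' m'" and le: "n' \<le> n" "m' \<le> m"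
  defines "c \<equiv> f $ n $ m / s $ n' $ m'"
  shows "f - term2 c (n - n') (m - m') * s \<in> vanishing (Suc (prod_encode (n, m)))"
proof (rule vanishing_SucI)
  have "term2 c (n - n') (m - m') * s \<in> vanishing (prod_encode (n, m))"
    unfolding vanishing_def
  proof (intro CollectI allI impI)
    fix a b assume *: "prod_encode (a, b) < prod_encode (n, m)"
    show "(term2 c (n - n') (m - m') * s) $ a $ b = 0"
    proof (cases "n - n' \<le> a \<and> m - m' \<le> b")
      case True
      then obtain a' b' where ab: "a = a' + (n - n')" "b = b' + (m - m')" by (metis le_add_diff_inverse2)
      have nm: "n = n' + (n - n')" "m = m' + (m - m')" using le by simp_all
      have "prod_encode (a' + (n - n'), b' + (m - m')) < prod_encode (n' + (n - n'), m' + (m - m'))"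
        using * ab nm by metis
      then have "prod_encode (a - (n - n'), b - (m - m')) < prod_encode (n', m')"
        unfolding prod_encode_shift_less_iff using ab by simp
      then show ?thesis using s unfolding leading_at_def vanishing_def by (auto simp: term2_mult_nth)
    qed (auto simp: term2_mult_nth)
  qed
  then show "f - term2 c (n - n') (m - m') * s \<in> vanishing (prod_encode (n, m))"
    using f vanishing_closed unfolding leading_at_def by blast
  show "(f - term2 c (n - n') (m - m') * s) $ n $ m = 0"
    using le s unfolding leading_at_def by (simp add: term2_mult_nth c_def)
qed

section \<open>Division by leading terms\<close>

text \<open>
  The solutions to order \<open>j\<close> form affine spaces that decrease with \<open>j\<close>, and the equation is continuous
  in its unknowns, so a limit point of these spaces is a solution. For series over \<open>K\<close> this says that
  finitely generated ideals are closed.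
\<close>
lemma linear_equation_limit:
  fixes f :: "'k::field fps2" and s :: "nat \<Rightarrow> 'k fps2"
  assumes K: "subfield_set K"
    and approx: "\<And>j. \<exists>h. (\<forall>i. h i \<in> fps2_over K) \<and> f - (\<Sum>i<r. s i * h i) \<in> vanishing j"
  obtains h where "\<And>i. h i \<in> fps2_over K" "f = (\<Sum>i<r. s i * h i)"
proof -
  define mk :: "(nat \<times> nat \<times> nat \<Rightarrow> 'k) \<Rightarrow> nat \<Rightarrow> 'k fps2"
    where "mk H i = Abs_fps (\<lambda>n. Abs_fps (\<lambda>m. H (i, n, m)))" for H i
  have mk_nth: "mk H i $ n $ m = H (i, n, m)" for H i n m by (simp add: mk_def)
  define D where "D H = f - (\<Sum>i<r. s i * mk H i)" for H
  define A where "A j = {H. (\<forall>x. H x \<in> K) \<and> D H \<in> vanishing j}" for j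
  obtain g where gK: "\<And>i. g i \<in> K" and g: "\<And>n F. finite F \<Longrightarrow> \<exists>a\<in>A n. \<forall>i\<in>F. a i = g i"
  proof (rule affine_sequence_limit[OF K, of A])
    show "decseq A" unfolding decseq_def A_def using vanishing_antimono by blast
    show "A n \<noteq> {}" for n
    proof -
      obtain h where h: "\<And>i. h i \<in> fps2_over K" "f - (\<Sum>i<r. s i * h i) \<in> vanishing n" using approx by blast
      define H where "H = (\<lambda>(i, n, m). h i $ n $ m)"
      have "mk H i = h i" for i by (intro fps_ext) (simp add: mk_nth H_def)
      then have "H \<in> A n" unfolding A_def D_def using h by (auto simp: H_def fps2_over_def)
      then show ?thesis by blast
    qed
    show "a i \<in> K" if "a \<in> A n" for n a i using that unfolding A_def by blast
    fix n a b t assume ab: "a \<in> A n" "b \<in> A n" "t \<in> K"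
    define C where "C = fps_const (fps_const t)"
    have mk_affine: "mk (\<lambda>i. a i + t * (b i - a i)) i = mk a i + C * (mk b i - mk a i)" for i
      by (intro fps_ext) (simp add: mk_nth C_def)
    have "D (\<lambda>i. a i + t * (b i - a i)) = D a + C * (D b - D a)"
      unfolding D_def mk_affine by (simp add: algebra_simps sum.distrib sum_subtractf sum_distrib_left)
    moreover have "D a \<in> vanishing n" "D b \<in> vanishing n" using ab unfolding A_def by blast+
    ultimately have "D (\<lambda>i. a i + t * (b i - a i)) \<in> vanishing n"
      by (simp only: vanishing_closed vanishing_mult)
    then show "(\<lambda>i. a i + t * (b i - a i)) \<in> A n" using ab K unfolding A_def by (auto simp: subfield_setD)
  qed blast
  have "D g \<in> vanishing j" for j
  proof -
    have "finite {p. prod_encode p < j}" using finite_vimageI[OF finite_lessThan[of j] inj_prod_encode] by (simp add: vimage_def)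
    then have "finite ({..<r} \<times> {p. prod_encode p < j})" by simp
    from g[OF this] obtain a where a: "a \<in> A j" "\<forall>x\<in>{..<r} \<times> {p. prod_encode p < j}. a x = g x" by blast
    have "mk g i - mk a i \<in> vanishing j" if "i < r" for i
      using a(2) that by (auto simp: vanishing_def mk_nth)
    then have "(\<Sum>i<r. s i * (mk g i - mk a i)) \<in> vanishing j" by (intro vanishing_sum vanishing_mult) auto
    moreover have "D g = D a - (\<Sum>i<r. s i * (mk g i - mk a i))"
      unfolding D_def by (simp add: algebra_simps sum_subtractf)
    ultimately show ?thesis using a(1) vanishing_closed unfolding A_def by auto
  qed
  then have "D g = 0" by (rule vanishing_all_zero)
  show thesis
  proof (rule that)
    show "mk g i \<in> fps2_over K" for i using gK by (simp add: fps2_over_def mk_nth)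
    show "f = (\<Sum>i<r. s i * mk g i)" using \<open>D g = 0\<close> by (simp add: D_def)
  qed
qed

text \<open>
  The coefficients of \<open>h\<close> stay in the field \<open>K\<close> that contains those of \<open>f\<close> and of all \<open>s i\<close>, even
  though \<open>G\<close> may contain series with coefficients outside \<open>K\<close>. The set \<open>G\<close> stands for the possible
  remainders.
\<close>
lemma division_by_leading_terms:
  fixes f :: "'k::field fps2" and s :: "nat \<Rightarrow> 'k fps2"
  assumes K: "subfield_set K"
    and f: "f \<in> fps2_over K" "f \<in> G"
    and s: "\<And>i. i < r \<Longrightarrow> s i \<in> fps2_over K"
    and G: "\<And>g i h. g \<in> G \<Longrightarrow> i < r \<Longrightarrow> h \<in> fps2_over K \<Longrightarrow> g - s i * h \<in> G"
    and lead: "\<And>g n m. g \<in> G \<Longrightarrow> leading_at g n m \<Longrightarrow> \<exists>i<r. \<exists>n'\<le>n. \<exists>m'\<le>m. leading_at (s i) n' m'"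
  obtains h where "\<And>i. h i \<in> fps2_over K" "f = (\<Sum>i<r. s i * h i)"
proof (rule linear_equation_limit[OF K])
  fix j
  have "\<exists>h. (\<forall>i. h i \<in> fps2_over K) \<and> f - (\<Sum>i<r. s i * h i) \<in> vanishing j \<inter> G"
  proof (induction j)
    case 0
    then show ?case using f by (intro exI[of _ "\<lambda>_. 0"]) (auto simp: fps2_over_closed K vanishing_0)
  next
    case (Suc j)
    then obtain h where h: "\<And>i. h i \<in> fps2_over K" and D: "f - (\<Sum>i<r. s i * h i) \<in> vanishing j \<inter> G" by blast
    define D where "D = f - (\<Sum>i<r. s i * h i)"
    have DK: "D \<in> fps2_over K" unfolding D_def by (intro fps2_over_closed[OF K] fps2_over_sum[OF K] f s h) auto
    obtain n m where j: "j = prod_encode (n, m)" by (metis prod_decode_inverse surj_pair)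
    show ?case
    proof (cases "D $ n $ m = 0")
      case True
      then have "D \<in> vanishing (Suc j)" using D vanishing_SucI unfolding D_def j by blast
      then show ?thesis using h D unfolding D_def by blast
    next
      case False
      then have leadD: "leading_at D n m" unfolding leading_at_def using D j D_def by blast
      then obtain i n' m' where i: "i < r" and le: "n' \<le> n" "m' \<le> m" and leads: "leading_at (s i) n' m'"
        using lead D D_def by blast
      \<comment> \<open>The quotient of the leading terms cancels the term of the remainder at position \<open>j\<close>.\<close>
      define t where "t = term2 (D $ n $ m / s i $ n' $ m') (n - n') (m - m')"
      have "D $ n $ m \<in> K" "s i $ n' $ m' \<in> K" using DK s[OF i] unfolding fps2_over_def by blast+
      then have tK: "t \<in> fps2_over K" unfolding t_def by (intro fps2_over_closed subfield_setD K)
      define h' where "h' = h(i := h i + t)"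
      have "(\<Sum>k<r. s k * h' k) = (\<Sum>k<r. s k * h k + (if k = i then s i * t else 0))"
        by (intro sum.cong) (auto simp: h'_def algebra_simps)
      then have eq: "f - (\<Sum>k<r. s k * h' k) = D - s i * t"
        using i by (simp add: sum.distrib D_def)
      have "D - s i * t \<in> vanishing (Suc j)"
        using leading_at_reduce[OF leadD leads le] unfolding t_def j by (simp add: mult.commute)
      moreover have "D - s i * t \<in> G" using G[OF _ i tK] D D_def by blast
      moreover have "\<forall>k. h' k \<in> fps2_over K" using h tK K by (auto simp: h'_def fps2_over_closed)
      ultimately show ?thesis unfolding eq[symmetric] by blast
    qed
  qed
  then show "\<exists>h. (\<forall>i. h i \<in> fps2_over K) \<and> f - (\<Sum>i<r. s i * h i) \<in> vanishing j" by blast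
qed (use that in blast)

section \<open>Squares in characteristic two\<close>

text \<open>
  The involution \<open>i \<mapsto> n - i\<close> pairs equal terms, which cancel. Only its fixed point survives.
\<close>
lemma char_two_sum_square:
  fixes f :: "nat \<Rightarrow> 'a::comm_ring_1"
  assumes "(1::'a) + 1 = 0"
  shows "(\<Sum>i\<le>n. f i * f (n - i)) = (if even n then f (n div 2) * f (n div 2) else 0)"
proof -
  let ?g = "\<lambda>i. f i * f (n - i)"
  have "sum ?g {i. n < 2 * i \<and> i \<le> n} = sum ?g {i. 2 * i < n}"
    by (rule sum.reindex_bij_witness[of _ "\<lambda>i. n - i" "\<lambda>i. n - i"]) auto
  moreover have "x + x = 0" for x :: 'a using assms by (metis distrib_left mult.right_neutral mult_zero_right)
  ultimately have z: "sum ?g {i. 2 * i < n} + sum ?g {i. n < 2 * i \<and> i \<le> n} = 0" by simp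
  have "{..n} = ({i. 2 * i < n} \<union> {i. n < 2 * i \<and> i \<le> n}) \<union> {i. 2 * i = n}" by auto
  moreover have "finite {i. 2 * i < n}" "finite {i. 2 * i = n}" by (rule finite_subset[of _ "{..n}"]; auto)+
  ultimately have "sum ?g {..n} = sum ?g {i. 2 * i < n} + sum ?g {i. n < 2 * i \<and> i \<le> n} + sum ?g {i. 2 * i = n}"
    by (simp only:) (subst sum.union_disjoint; auto)+
  also have "\<dots> = sum ?g {i. 2 * i = n}" by (simp only: z) simp
  also have "{i. 2 * i = n} = (if even n then {n div 2} else {})" by auto
  finally show ?thesis by (auto elim: evenE)
qed

lemma fps2_square_nth:
  fixes f :: "'k::field fps2"
  assumes "(1::'k) + 1 = 0"
  shows "(f * f) $ n $ m = (if even n \<and> even m then f $ (n div 2) $ (m div 2) * f $ (n div 2) $ (m div 2) else 0)"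
proof -
  have "(1 :: 'k fps) + 1 = 0" using arg_cong[OF assms, of fps_const] by (simp only: fps_const_add[symmetric] fps_const_1_eq_1 fps_const_0_eq_0)
  then have "(f * f) $ n = (if even n then f $ (n div 2) * f $ (n div 2) else 0)"
    using char_two_sum_square[of "fps_nth f" n] by (simp add: fps_mult_nth atLeast0AtMost)
  then show ?thesis using char_two_sum_square[OF assms, of "fps_nth (f $ (n div 2))" m]
    by (simp add: fps_mult_nth atLeast0AtMost)
qed

section \<open>Subrings and their ideals\<close>

definition subring_record :: "'a::comm_ring_1 set \<Rightarrow> 'a ring"
  where "subring_record S = \<lparr>carrier = S, monoid.mult = (*), one = 1, ring.zero = 0, ring.add = (+)\<rparr>"

lemma subring_record_simps [simp]:
  "carrier (subring_record S) = S" "monoid.mult (subring_record S) = (*)" "one (subring_record S) = 1"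
  "ring.zero (subring_record S) = 0" "ring.add (subring_record S) = (+)"
  by (simp_all add: subring_record_def)

locale closed_subring =
  fixes S :: "'a::comm_ring_1 set"
  assumes one_mem: "1 \<in> S" and diff_mem: "a \<in> S \<Longrightarrow> b \<in> S \<Longrightarrow> a - b \<in> S"
    and mult_mem: "a \<in> S \<Longrightarrow> b \<in> S \<Longrightarrow> a * b \<in> S"
begin

lemma zero_mem: "0 \<in> S" using diff_mem[OF one_mem one_mem] by simp

lemma uminus_mem: "a \<in> S \<Longrightarrow> - a \<in> S" using diff_mem[OF zero_mem] by simp

lemma add_mem: "a \<in> S \<Longrightarrow> b \<in> S \<Longrightarrow> a + b \<in> S" using diff_mem[of a "- b"] uminus_mem by simp

lemma cring_record: "cring (subring_record S)"
proof (rule cringI)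
  show "abelian_group (subring_record S)"
  proof (rule abelian_groupI)
    fix x assume "x \<in> carrier (subring_record S)"
    then show "\<exists>y\<in>carrier (subring_record S). y \<oplus>\<^bsub>subring_record S\<^esub> x = \<zero>\<^bsub>subring_record S\<^esub>"
      using uminus_mem by (intro bexI[of _ "- x"]) auto
  qed (auto simp: zero_mem add_mem ac_simps)
  show "comm_monoid (subring_record S)"
    by (rule comm_monoidI) (auto simp: one_mem mult_mem ac_simps)
qed (auto simp: algebra_simps)

sublocale R: cring "subring_record S" by (rule cring_record)

text \<open>
  Ideals of the record are described in terms of the ambient operations, so that the
  arguments about ideals can be carried out in the type of power series.
\<close>
lemma ideal_record_iff:
  "ideal I (subring_record S) \<longleftrightarrow>
    I \<subseteq> S \<and> 0 \<in> I \<and> (\<forall>a\<in>I. \<forall>b\<in>I. a - b \<in> I) \<and> (\<forall>a\<in>I. \<forall>r\<in>S. r * a \<in> I)"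
proof
  assume "ideal I (subring_record S)"
  then interpret ideal I "subring_record S" .
  have I: "I \<subseteq> S" using a_subset by simp
  have mul: "r * a \<in> I" if "a \<in> I" "r \<in> S" for a r using I_l_closed[of a r] that by simp
  have "a - b \<in> I" if "a \<in> I" "b \<in> I" for a b
  proof -
    have "(-1) * b \<in> I" using mul[OF that(2) uminus_mem[OF one_mem]] .
    then show ?thesis using a_closed[OF that(1), of "- b"] by simp
  qed
  then show "I \<subseteq> S \<and> 0 \<in> I \<and> (\<forall>a\<in>I. \<forall>b\<in>I. a - b \<in> I) \<and> (\<forall>a\<in>I. \<forall>r\<in>S. r * a \<in> I)"
    using I mul zero_closed by simp
next
  assume *: "I \<subseteq> S \<and> 0 \<in> I \<and> (\<forall>a\<in>I. \<forall>b\<in>I. a - b \<in> I) \<and> (\<forall>a\<in>I. \<forall>r\<in>S. r * a \<in> I)"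
  have um: "- a \<in> I" if "a \<in> I" for a using * that by (metis diff_0)
  have ad: "a + b \<in> I" if "a \<in> I" "b \<in> I" for a b using * that um[of b] by (metis diff_minus_eq_add)
  show "ideal I (subring_record S)"
  proof (rule idealI)
    show "subgroup I (add_monoid (subring_record S))"
    proof (rule subgroup.intro)
      fix x assume x: "x \<in> I"
      then have "\<ominus>\<^bsub>subring_record S\<^esub> x = - x"
        using * um by (intro R.minus_equality) auto
      then show "inv\<^bsub>add_monoid (subring_record S)\<^esub> x \<in> I" using um[OF x] by (simp add: a_inv_def)
    qed (use * ad in auto)
    show "x \<otimes>\<^bsub>subring_record S\<^esub> a \<in> I" "a \<otimes>\<^bsub>subring_record S\<^esub> x \<in> I"
      if "a \<in> I" "x \<in> carrier (subring_record S)" for a x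
      using * that by (auto simp: mult.commute)
  qed (rule R.ring_axioms)
qed

lemma ideal_recordD:
  assumes "ideal I (subring_record S)"
  shows "I \<subseteq> S" "0 \<in> I" "a \<in> I \<Longrightarrow> b \<in> I \<Longrightarrow> a - b \<in> I" "a \<in> I \<Longrightarrow> b \<in> I \<Longrightarrow> a + b \<in> I"
    "a \<in> I \<Longrightarrow> r \<in> S \<Longrightarrow> r * a \<in> I" "a \<in> I \<Longrightarrow> r \<in> S \<Longrightarrow> a * r \<in> I"
proof -
  have *: "I \<subseteq> S \<and> 0 \<in> I \<and> (\<forall>a\<in>I. \<forall>b\<in>I. a - b \<in> I) \<and> (\<forall>a\<in>I. \<forall>r\<in>S. r * a \<in> I)"
    using assms unfolding ideal_record_iff .
  show "I \<subseteq> S" and zero: "0 \<in> I" using * by simp_all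
  show diff: "a - b \<in> I" if "a \<in> I" "b \<in> I" for a b using * that by simp
  show "a + b \<in> I" if "a \<in> I" "b \<in> I" using diff[OF that(1) diff[OF zero that(2)]] by simp
  show mul: "r * a \<in> I" if "a \<in> I" "r \<in> S" using * that by simp
  show "a * r \<in> I" if "a \<in> I" "r \<in> S" using mul[OF that] by (simp only: mult.commute)
qed

lemma ideal_record_sum:
  assumes "ideal I (subring_record S)" "\<And>i. i \<in> A \<Longrightarrow> f i \<in> I" shows "sum f A \<in> I"
  using assms(2) by (induction A rule: infinite_finite_induct) (auto simp: ideal_recordD[OF assms(1)])

end

section \<open>The ring of series defined over a member of the chain\<close>

context square_subfield_chain
begin

definition chain_series :: "'k fps2 set" where "chain_series = (\<Union>i. fps2_over (K i))"

lemma finite_subset_fps2_over: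
  assumes "finite A" "A \<subseteq> chain_series" obtains i where "A \<subseteq> fps2_over (K i)"
proof -
  have "\<exists>i. A \<subseteq> fps2_over (K i)" using assms
  proof (induction A rule: finite_induct)
    case (insert x A)
    then obtain i j where "A \<subseteq> fps2_over (K i)" "x \<in> fps2_over (K j)" unfolding chain_series_def by blast
    moreover have "fps2_over (K i) \<subseteq> fps2_over (K (max i j))" "fps2_over (K j) \<subseteq> fps2_over (K (max i j))"
      by (intro fps2_over_mono monoD[OF mono_chain]; simp)+
    ultimately have "insert x A \<subseteq> fps2_over (K (max i j))" by blast
    then show ?case ..
  qed simp
  then show ?thesis using that by blast
qed

lemma fps2_over_subset: "fps2_over (K i) \<subseteq> chain_series" by (auto simp: chain_series_def)

lemma term2_mem: "term2 c a b \<in> chain_series"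
  using exhaust_chain[of c] fps2_over_closed(6)[OF subfield_chain] fps2_over_subset by blast

sublocale closed_subring chain_series
proof
  show "1 \<in> chain_series" using fps2_over_closed(2)[OF subfield_chain] fps2_over_subset by blast
  fix a b assume "a \<in> chain_series" "b \<in> chain_series"
  then obtain i where "{a, b} \<subseteq> fps2_over (K i)" using finite_subset_fps2_over[of "{a, b}"] by auto
  then have "a - b \<in> fps2_over (K i)" "a * b \<in> fps2_over (K i)"
    using fps2_over_closed[OF subfield_chain] by auto
  then show "a - b \<in> chain_series" "a * b \<in> chain_series" using fps2_over_subset by blast+
qed

abbreviation chain_ring where "chain_ring \<equiv> subring_record chain_series"

lemma square_mem: "g * g \<in> chain_series"
proof -
  have "g * g \<in> fps2_over (K 0)"
    using squares_chain subfield_setD(2)[OF subfield_chain] by (auto simp: fps2_over_def fps2_square_nth[OF char_two])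
  then show ?thesis using fps2_over_subset by blast
qed

definition in_closure :: "'k fps2 set \<Rightarrow> 'k fps2 \<Rightarrow> bool"
  where "in_closure I f \<longleftrightarrow> (\<forall>j. \<exists>g\<in>I. f - g \<in> vanishing j)"

text \<open>
  By Dickson's lemma there are finitely many elements of \<open>I\<close> whose leading monomials generate, under
  divisibility, the leading monomials of \<open>I\<close> and hence those of its closure. As only finitely many
  series are involved, dividing by them takes place over a single member of the chain. Applied to \<open>I\<close>
  the conclusion is finite generation, and applied to the closure it is closedness.
\<close>
lemma standard_basis:
  assumes I: "ideal I chain_ring"
  shows "\<exists>r s. (\<forall>i<r::nat. s i \<in> I) \<and>
    (\<forall>f\<in>chain_series. in_closure I f \<longrightarrow> (\<exists>h. (\<forall>i. h i \<in> chain_series) \<and> f = (\<Sum>i<r. s i * h i)))"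
proof -
  define L where "L = {(n, m). \<exists>g\<in>I. leading_at g n m}"
  obtain F where F: "finite F" "F \<subseteq> L" "\<And>n m. (n, m) \<in> L \<Longrightarrow> \<exists>(n', m')\<in>F. n' \<le> n \<and> m' \<le> m"
    using dickson_pairs[of L] by metis
  obtain l where l: "set l = F" using finite_list[OF F(1)] by blast
  define s where "s i = (SOME g. g \<in> I \<and> leading_at g (fst (l ! i)) (snd (l ! i)))" for i
  have s: "s i \<in> I \<and> leading_at (s i) (fst (l ! i)) (snd (l ! i))" if "i < length l" for i
  proof -
    have "l ! i \<in> L" using that l F(2) nth_mem by blast
    then have "\<exists>g. g \<in> I \<and> leading_at g (fst (l ! i)) (snd (l ! i))"
      unfolding L_def by (simp only: mem_Collect_eq case_prod_beta Bex_def)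
    then show ?thesis unfolding s_def by (rule someI_ex)
  qed
  show ?thesis
  proof (rule exI[of _ "length l"], rule exI[of _ s], intro conjI ballI impI allI)
    show "s i \<in> I" if "i < length l" for i using s that by blast
    fix f assume f: "f \<in> chain_series" "in_closure I f"
    have "insert f (s ` {..<length l}) \<subseteq> chain_series" using f s ideal_recordD(1)[OF I] by auto
    then obtain k where k: "insert f (s ` {..<length l}) \<subseteq> fps2_over (K k)" using finite_subset_fps2_over by (metis finite_imageI finite_insert finite_lessThan)
    obtain h where h: "\<And>i. h i \<in> fps2_over (K k)" and fh: "f = (\<Sum>i<length l. s i * h i)"
    proof (rule division_by_leading_terms[OF subfield_chain, of f k "Collect (in_closure I)" "length l" s])
      show "f \<in> fps2_over (K k)" "f \<in> Collect (in_closure I)" using k f by auto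
      show "s i \<in> fps2_over (K k)" if "i < length l" for i using k that by auto
      show "g - s i * h \<in> Collect (in_closure I)" 
        if g: "g \<in> Collect (in_closure I)" and ih: "i < length l" "h \<in> fps2_over (K k)" for g i h
      proof -
        have sh: "s i * h \<in> I" using s ih fps2_over_subset ideal_recordD(6)[OF I] by blast
        have "\<exists>a\<in>I. g - s i * h - a \<in> vanishing j" for j
        proof -
          obtain a where "a \<in> I" "g - a \<in> vanishing j" using g unfolding in_closure_def by blast
          then show ?thesis using sh by (intro bexI[of _ "a - s i * h"]) (auto simp: ideal_recordD[OF I])
        qed
        then show ?thesis unfolding in_closure_def by blast
      qed
      fix g n m assume g: "g \<in> Collect (in_closure I)" "leading_at g n m"
      then obtain a where a: "a \<in> I" "g - a \<in> vanishing (Suc (prod_encode (n, m)))" unfolding in_closure_def by blast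
      then have "(n, m) \<in> L" using leading_at_cong[OF g(2)] unfolding L_def by blast
      then obtain n' m' where nm: "(n', m') \<in> F" "n' \<le> n" "m' \<le> m" using F(3) by blast
      then obtain i where "i < length l" "l ! i = (n', m')" using l by (metis in_set_conv_nth)
      then show "\<exists>i<length l. \<exists>n'\<le>n. \<exists>m'\<le>m. leading_at (s i) n' m'" using s nm by force
    qed blast
    show "\<exists>h. (\<forall>i. h i \<in> chain_series) \<and> f = (\<Sum>i<length l. s i * h i)"
      using fps2_over_subset[of k] by (intro exI[of _ h] conjI allI subsetD[OF _ h] fh)
  qed
qed

lemma in_closure_self: "f \<in> I \<Longrightarrow> in_closure I f"
  unfolding in_closure_def by (intro allI bexI[of _ f]) (simp_all add: vanishing_closed)

text \<open>
  In other words, the quotients of the ring satisfy Krull's intersection theorem.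
\<close>
lemma ideal_closed:
  assumes "ideal I chain_ring" "f \<in> chain_series" "in_closure I f" shows "f \<in> I"
proof -
  obtain r s where rs: "\<And>i. i < (r::nat) \<Longrightarrow> s i \<in> I"
    "\<And>f. f \<in> chain_series \<Longrightarrow> in_closure I f \<Longrightarrow> \<exists>h. (\<forall>i. h i \<in> chain_series) \<and> f = (\<Sum>i<r. s i * h i)"
    using standard_basis[OF assms(1)] by blast
  obtain h where h: "\<And>i. h i \<in> chain_series" and f: "f = (\<Sum>i<r. s i * h i)" using rs(2)[OF assms(2,3)] by blast
  show ?thesis unfolding f by (intro ideal_record_sum[OF assms(1)] ideal_recordD(6)[OF assms(1)] rs(1) h) simp
qed

lemma noetherian_chain_ring: "noetherian_ring chain_ring"
proof (rule R.noetherian_ringI)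
  fix I assume I: "ideal I chain_ring"
  obtain r s where rs: "\<And>i. i < (r::nat) \<Longrightarrow> s i \<in> I"
    "\<And>f. f \<in> chain_series \<Longrightarrow> in_closure I f \<Longrightarrow> \<exists>h. (\<forall>i. h i \<in> chain_series) \<and> f = (\<Sum>i<r. s i * h i)"
    using standard_basis[OF I] by blast
  let ?A = "s ` {..<r}"
  have A: "?A \<subseteq> I" "?A \<subseteq> carrier chain_ring" using rs(1) ideal_recordD(1)[OF I] by auto
  have J: "ideal (Idl\<^bsub>chain_ring\<^esub> ?A) chain_ring" using R.genideal_ideal[OF A(2)] .
  have "I \<subseteq> Idl\<^bsub>chain_ring\<^esub> ?A"
  proof
    fix f assume "f \<in> I"
    then have "f \<in> chain_series" "in_closure I f" using in_closure_self ideal_recordD(1)[OF I] by blast+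
    then obtain h where h: "\<And>i. h i \<in> chain_series" and f: "f = (\<Sum>i<r. s i * h i)"
      using rs(2) by blast
    have s: "s i \<in> Idl\<^bsub>chain_ring\<^esub> ?A" if "i < r" for i using R.genideal_self[OF A(2)] that by blast
    show "f \<in> Idl\<^bsub>chain_ring\<^esub> ?A"
      unfolding f by (intro ideal_record_sum[OF J] ideal_recordD(6)[OF J] s h) simp
  qed
  then have "I = Idl\<^bsub>chain_ring\<^esub> ?A" using R.genideal_minimal[OF I A(1)] by blast
  then show "\<exists>A\<subseteq>carrier chain_ring. finite A \<and> I = Idl\<^bsub>chain_ring\<^esub> A" using A(2) by blast
qed

definition max_ideal :: "'k fps2 set" where "max_ideal = {f\<in>chain_series. f $ 0 $ 0 = 0}"

text \<open>
  The leading monomial of \<open>f\<close> is \<open>1\<close>, which divides every monomial, so division of \<open>1\<close> by \<open>f\<close> leaves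
  no remainder.
\<close>
lemma unit_mem:
  assumes f: "f \<in> chain_series" "f $ 0 $ 0 \<noteq> 0" obtains g where "g \<in> chain_series" "f * g = 1"
proof -
  obtain i where i: "f \<in> fps2_over (K i)" using f unfolding chain_series_def by blast
  have lead: "leading_at f 0 0" using f(2) by (simp add: leading_at_def vanishing_def prod_encode_def)
  obtain h :: "nat \<Rightarrow> 'k fps2" where h: "\<And>j. h j \<in> fps2_over (K i)" "1 = (\<Sum>j<1. f * h j)"
  proof (rule division_by_leading_terms[OF subfield_chain, of 1 i UNIV 1 "\<lambda>_. f"])
    show "\<exists>i<1::nat. \<exists>n'\<le>n. \<exists>m'\<le>m. leading_at f n' m'" for n m
      using lead by (metis le0 less_one)
  qed (use i fps2_over_closed(2)[OF subfield_chain] in \<open>blast intro: UNIV_I\<close>)+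
  have "h 0 \<in> chain_series" using h(1) fps2_over_subset by blast
  moreover have "f * h 0 = 1" using h(2) by simp
  ultimately show thesis by (rule that)
qed

lemma ideal_max_ideal: "ideal max_ideal chain_ring"
  unfolding ideal_record_iff max_ideal_def by (auto simp: zero_mem diff_mem mult_mem)

lemma proper_ideal_subset_max_ideal:
  assumes I: "ideal I chain_ring" "1 \<notin> I" shows "I \<subseteq> max_ideal"
proof
  fix f assume f: "f \<in> I"
  then have "f \<in> chain_series" using ideal_recordD(1)[OF I(1)] by blast
  moreover have "f $ 0 $ 0 = 0"
  proof (rule ccontr)
    assume "f $ 0 $ 0 \<noteq> 0"
    then obtain g where "g \<in> chain_series" "f * g = 1" using unit_mem \<open>f \<in> chain_series\<close> by blast
    then show False using ideal_recordD(6)[OF I(1) f] I(2) by metis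
  qed
  ultimately show "f \<in> max_ideal" unfolding max_ideal_def by blast
qed

lemma one_notin_max_ideal: "1 \<notin> max_ideal" by (simp add: max_ideal_def)

lemma noetherian_local_chain_ring: "noetherian_local_ring chain_ring max_ideal"
proof -
  have full: "J = chain_series" if "ideal J chain_ring" "1 \<in> J" for J
    using ideal_recordD[OF that(1)] that(2) by fastforce
  have max: "maximalideal max_ideal chain_ring"
  proof (rule maximalidealI)
    show "carrier chain_ring \<noteq> max_ideal" using one_notin_max_ideal one_mem by auto
    fix J assume J: "ideal J chain_ring" "max_ideal \<subseteq> J"
    show "J = max_ideal \<or> J = carrier chain_ring" using full[OF J(1)] proper_ideal_subset_max_ideal[OF J(1)] J(2) by auto
  qed (rule ideal_max_ideal)
  show ?thesis
  proof (intro noetherian_local_ring.intro noetherian_local_ring_axioms.intro noetherian_chain_ring cring_record max)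
    fix J assume "maximalideal J chain_ring"
    then interpret J: maximalideal J chain_ring .
    have "1 \<notin> J" using full[OF J.ideal_axioms] J.I_notcarr by auto
    then have "J \<subseteq> max_ideal" using proper_ideal_subset_max_ideal[OF J.ideal_axioms] by blast
    moreover have "max_ideal \<noteq> carrier chain_ring" using one_notin_max_ideal one_mem by auto
    moreover have "max_ideal \<subseteq> carrier chain_ring" by (auto simp: max_ideal_def)
    ultimately show "J = max_ideal" using J.I_maximal[OF ideal_max_ideal] by blast
  qed
qed

lemma vanishing_triangle: "f \<in> vanishing (triangle k) \<longleftrightarrow> (\<forall>n m. n + m < k \<longrightarrow> f $ n $ m = 0)"
  unfolding vanishing_def using prod_encode_ge_triangle_iff by (auto simp flip: not_le)

lemma ideal_power_Suc: "ideal_power chain_ring max_ideal (Suc k) = ideal_prod chain_ring (ideal_power chain_ring max_ideal k) max_ideal"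
  by (simp add: ideals_set_def)

lemma ideal_power_0: "ideal_power chain_ring max_ideal 0 = chain_series" by (simp add: ideals_set_def)

lemma ideal_power_ideal: "ideal (ideal_power chain_ring max_ideal k) chain_ring"
proof (induction k)
  case 0 then show ?case unfolding ideal_power_0 using R.oneideal by simp
next
  case (Suc k) then show ?case unfolding ideal_power_Suc by (rule R.ideal_prod_is_ideal) (rule ideal_max_ideal)
qed

text \<open>
  A series without terms of degree at most \<open>k\<close> is \<open>y p + x q\<close> where \<open>p\<close> collects the terms divisible
  by \<open>y\<close>, and neither \<open>p\<close> nor \<open>q\<close> has terms of degree below \<open>k\<close>.
\<close>
lemma ideal_power_eq: "ideal_power chain_ring max_ideal k = chain_series \<inter> vanishing (triangle k)"
proof (induction k)
  case 0
  show ?case unfolding ideal_power_0 by (auto simp: vanishing_0)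
next
  case (Suc k)
  show ?case
  proof
    show "ideal_power chain_ring max_ideal (Suc k) \<subseteq> chain_series \<inter> vanishing (triangle (Suc k))"
    proof
      fix f assume "f \<in> ideal_power chain_ring max_ideal (Suc k)"
      then have "f \<in> ideal_prod chain_ring (ideal_power chain_ring max_ideal k) max_ideal" unfolding ideal_power_Suc .
      then show "f \<in> chain_series \<inter> vanishing (triangle (Suc k))"
      proof (induction rule: ideal_prod.induct)
        case (prod a b)
        have a: "a \<in> chain_series" "\<And>n m. n + m < k \<Longrightarrow> a $ n $ m = 0" using prod Suc by (auto simp: vanishing_triangle)
        have b: "b \<in> chain_series" "b $ 0 $ 0 = 0" using prod by (auto simp: max_ideal_def)
        have "a $ i $ j * b $ (n - i) $ (m - j) = 0" if "n + m < Suc k" "i \<le> n" "j \<le> m" for n m i j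
        proof (cases "i + j < k")
          case False
          then have "n - i = 0" "m - j = 0" using that by auto
          then show ?thesis using b by simp
        qed (use a in simp)
        then have "a * b \<in> vanishing (triangle (Suc k))" 
          by (simp only: vanishing_triangle fps2_mult_nth) (intro allI impI sum.neutral ballI; simp)
        then show ?case using a b mult_mem by simp
      qed (auto simp: add_mem vanishing_closed)
    qed
    show "chain_series \<inter> vanishing (triangle (Suc k)) \<subseteq> ideal_power chain_ring max_ideal (Suc k)"
    proof
      fix f assume f: "f \<in> chain_series \<inter> vanishing (triangle (Suc k))"
      then obtain i where i: "f \<in> fps2_over (K i)" unfolding chain_series_def by blast
      define p :: "'k fps2" where "p = Abs_fps (\<lambda>n. f $ Suc n)"
      define q :: "'k fps2" where "q = fps_const (Abs_fps (\<lambda>m. f $ 0 $ Suc m))"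
      have f0: "f $ n $ m = 0" if "n + m < Suc k" for n m using f that unfolding Int_iff vanishing_triangle by blast
      have pR: "p \<in> chain_series" "q \<in> chain_series" using i fps2_over_subset[of i] subfield_setD(2)[OF subfield_chain] by (auto simp: fps2_over_def p_def q_def)
      have "p \<in> vanishing (triangle k)" "q \<in> vanishing (triangle k)"
        unfolding vanishing_triangle using f0 by (auto simp: p_def q_def)
      then have pq: "p \<in> ideal_power chain_ring max_ideal k" "q \<in> ideal_power chain_ring max_ideal k" using pR Suc by auto
      have "term2 1 1 0 \<in> max_ideal" "term2 1 0 1 \<in> max_ideal" unfolding max_ideal_def using term2_mem by (auto simp: term2_nth)
      then have "p * term2 1 1 0 \<in> ideal_power chain_ring max_ideal (Suc k)" "q * term2 1 0 1 \<in> ideal_power chain_ring max_ideal (Suc k)"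
        unfolding ideal_power_Suc using ideal_prod.prod[OF pq(1), of _ max_ideal chain_ring] ideal_prod.prod[OF pq(2), of _ max_ideal chain_ring] by auto
      moreover have "f = term2 1 1 0 * p + term2 1 0 1 * q"
      proof (intro fps_ext)
        fix n m
        have "(term2 1 1 0 * p + term2 1 0 1 * q) $ n $ m =
            (if 1 \<le> n then p $ (n - 1) $ m else 0) + (if 1 \<le> m then q $ n $ (m - 1) else 0)"
          by (simp only: fps_add_nth term2_mult_nth mult_1 le0 simp_thms diff_zero)
        then show "f $ n $ m = (term2 1 1 0 * p + term2 1 0 1 * q) $ n $ m"
          using f0[of 0 0] by (cases n; cases m) (simp_all add: p_def q_def)
      qed
      then have "f = p * term2 1 1 0 + q * term2 1 0 1" by (simp only: mult.commute)
      ultimately show "f \<in> ideal_power chain_ring max_ideal (Suc k)" using ideal_recordD(4)[OF ideal_power_ideal] by metis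
    qed
  qed
qed

section \<open>Weak quasi-completeness\<close>

text \<open>
  Linear compactness gives a nonzero series in the closure of all ideals of the sequence. Its square
  has its coefficients in a member of the chain and therefore belongs to all these ideals.
\<close>
lemma weakly_quasi_complete_chain_ring: "weakly_quasi_complete chain_ring max_ideal"
  unfolding weakly_quasi_complete_def
proof (intro allI impI)
  fix I k assume I: "\<forall>n. ideal (I n) chain_ring" and dec: "decseq I" and int: "(\<Inter>n. I n) = {\<zero>\<^bsub>chain_ring\<^esub>}"
  show "\<exists>s. I s \<subseteq> ideal_power chain_ring max_ideal k"
  proof (rule ccontr)
    assume neg: "\<not> ?thesis"
    define coord where "coord f p = f $ fst p $ snd p" for f :: "'k fps2" and p
    \<comment> \<open>There are only finitely many monomials of degree below \<open>k\<close>, so if each were eventually absent from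
      all elements of \<open>I n\<close>, then some \<open>I n\<close> would lie in the \<open>k\<close>-th power.\<close>
    have "\<exists>p. \<forall>n. \<exists>f\<in>I n. coord f p \<noteq> 0"
    proof (rule ccontr)
      assume "\<not> ?thesis"
      then obtain N where N: "\<And>p f. f \<in> I (N p) \<Longrightarrow> coord f p = 0" by metis
      define s where "s = Max (N ` ({..k} \<times> {..k}))"
      have "I s \<subseteq> ideal_power chain_ring max_ideal k"
      proof
        fix f assume f: "f \<in> I s"
        have "f $ n $ m = 0" if "n + m < k" for n m
        proof -
          have "N (n, m) \<le> s" unfolding s_def using that by (intro Max_ge) auto
          then have "f \<in> I (N (n, m))" using f dec unfolding decseq_def by blast
          then show ?thesis using N[of f "(n, m)"] by (simp add: coord_def)
        qed
        then show "f \<in> ideal_power chain_ring max_ideal k"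
          unfolding ideal_power_eq using f ideal_recordD(1)[OF I[rule_format]] by (auto simp: vanishing_triangle)
      qed
      then show False using neg by blast
    qed
    then obtain p where p: "\<And>n. \<exists>f\<in>I n. coord f p \<noteq> 0" by blast
    \<comment> \<open>Fixing one coefficient to be \<open>1\<close> makes the limit nonzero and keeps the set affine.\<close>
    define A where "A n = {coord f |f. f \<in> I n \<and> coord f p = 1}" for n
    have coord_scale: "coord (term2 c 0 0 * f) = (\<lambda>x. c * coord f x)" for c f
      by (auto simp: coord_def term2_mult_nth)
    obtain a where a: "\<And>n F. finite F \<Longrightarrow> \<exists>b\<in>A n. \<forall>x\<in>F. b x = a x"
    proof (rule affine_sequence_limit[OF subfield_set_UNIV, of A])
      show "decseq A" using dec unfolding decseq_def A_def by blast
      show "A n \<noteq> {}" for n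
      proof -
        obtain f where f: "f \<in> I n" "coord f p \<noteq> 0" using p by blast
        have "term2 (inverse (coord f p)) 0 0 * f \<in> I n" using ideal_recordD(5)[OF I[rule_format] f(1) term2_mem] .
        moreover have "coord (term2 (inverse (coord f p)) 0 0 * f) p = 1" unfolding coord_scale using f by simp
        ultimately show ?thesis unfolding A_def by blast
      qed
      fix n b c t assume "b \<in> A n" "c \<in> A n"
      then obtain f g where f: "b = coord f" "f \<in> I n" "coord f p = 1" and g: "c = coord g" "g \<in> I n" "coord g p = 1"
        unfolding A_def by blast
      have "f + term2 t 0 0 * (g - f) \<in> I n"
        using f g term2_mem ideal_recordD[OF I[rule_format]] by metis
      moreover have eq: "coord (f + term2 t 0 0 * (g - f)) = (\<lambda>i. b i + t * (c i - b i))"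
        unfolding f g by (auto simp: coord_def term2_mult_nth)
      moreover have "coord (f + term2 t 0 0 * (g - f)) p = 1" unfolding eq using f g by simp
      ultimately show "(\<lambda>i. b i + t * (c i - b i)) \<in> A n" unfolding A_def by (metis (mono_tags, lifting) mem_Collect_eq)
    qed auto
    define g :: "'k fps2" where "g = Abs_fps (\<lambda>n. Abs_fps (\<lambda>m. a (n, m)))"
    have g_nth: "g $ n $ m = a (n, m)" for n m by (simp add: g_def)
    have approx: "\<exists>f\<in>I n. g - f \<in> vanishing j" for n j
    proof -
      have "finite {p. prod_encode p < j}" using finite_vimageI[OF finite_lessThan[of j] inj_prod_encode] by (simp add: vimage_def)
      from a[OF this] obtain f where f: "f \<in> I n" "\<forall>x\<in>{p. prod_encode p < j}. coord f x = a x" unfolding A_def by blast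
      then have "g - f \<in> vanishing j" by (auto simp: vanishing_def g_nth coord_def)
      then show ?thesis using f by blast
    qed
    have "g \<noteq> 0"
    proof
      assume "g = 0"
      then have "a p = 0" using g_nth[of "fst p" "snd p"] by simp
      moreover have "a p = 1" using a[of "{p}" 0] unfolding A_def by auto
      ultimately show False by simp
    qed
    have "g * g \<in> I n" for n
    proof (rule ideal_closed[OF I[rule_format] square_mem])
      show "in_closure (I n) (g * g)" unfolding in_closure_def
      proof
        fix j
        obtain f where f: "f \<in> I n" "g - f \<in> vanishing j" using approx by blast
        have "f * f \<in> I n" using f ideal_recordD[OF I[rule_format]] by blast
        \<comment> \<open>Differences of squares factor, so the square of a good approximation is a good approximation.\<close>
        moreover have "g * g - f * f = (g + f) * (g - f)" by (simp add: algebra_simps)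
        then have "g * g - f * f \<in> vanishing j" using vanishing_mult[OF f(2)] by simp
        ultimately show "\<exists>h\<in>I n. g * g - h \<in> vanishing j" by blast
      qed
    qed
    then have "g * g \<in> (\<Inter>n. I n)" by blast
    then have "g * g = 0" unfolding int by simp
    then show False using \<open>g \<noteq> 0\<close> by simp
  qed
qed

end

section \<open>Failure of quasi-completeness\<close>

context square_subfield_chain
begin

text \<open>
  The constant coefficient is zero so that \<open>y - c\<close>, for this series \<open>c\<close>, is not a unit.
\<close>
definition escaping :: "'k fps" where "escaping = Abs_fps (\<lambda>i. if i = 0 then 0 else (SOME x. x \<notin> K i))"

lemma escaping_nth: "escaping $ 0 = 0" "escaping $ Suc i \<notin> K (Suc i)"
proof -
  show "escaping $ 0 = 0" by (simp add: escaping_def)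
  have "\<exists>x. x \<notin> K (Suc i)" using proper_chain by blast
  then have "(SOME x. x \<notin> K (Suc i)) \<notin> K (Suc i)" by (rule someI_ex)
  then show "escaping $ Suc i \<notin> K (Suc i)" by (simp add: escaping_def)
qed

text \<open>
  This is \<open>y - c\<close>. Its square \<open>y\<^sup>2 - c\<^sup>2\<close> lies in the ring and generates a prime ideal whose extension
  to the completion is not reduced; this is what obstructs quasi-completeness.
\<close>
definition branch :: "'k fps2" where "branch = fps_X - fps_const escaping"

lemma branch_mult_nth: "(branch * h) $ 0 = - (escaping * h $ 0)" "(branch * h) $ Suc n = h $ n - escaping * h $ Suc n"
  by (simp_all add: branch_def left_diff_distrib)

lemma branch_nth: "branch $ 0 = - escaping" "branch $ Suc 0 = 1" by (simp_all add: branch_def)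

text \<open>
  Suppose that \<open>f = (y - c) h\<close> has coefficients in \<open>K i\<close> and that \<open>h\<close> is a unit. Comparing coefficients
  of \<open>y\<^sup>0\<close> gives \<open>c h\<^sub>0 = - f\<^sub>0\<close>, and comparing those of higher powers of \<open>y\<close> gives
  \<open>h\<^sub>n = f\<^sub>n\<^sub>+\<^sub>1 + c h\<^sub>n\<^sub>+\<^sub>1\<close>. By induction on the power of \<open>x\<close>, all coefficients of \<open>c\<close> and \<open>h\<close> lie in
  \<open>K i\<close>: as \<open>c\<close> has no constant term, the first equation determines the next coefficient of \<open>c\<close>, and
  then the second one that of every \<open>h\<^sub>n\<close>, from \<open>f\<close> and coefficients already found. But \<open>c\<close> has a
  coefficient outside \<open>K i\<close>.
\<close>
lemma cofactor_of_branch_not_unit: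
  assumes f: "branch * h \<in> chain_series" shows "h $ 0 $ 0 = 0"
proof (rule ccontr)
  assume h00: "h $ 0 $ 0 \<noteq> 0"
  obtain i where i: "branch * h \<in> fps2_over (K i)" using f unfolding chain_series_def by blast
  note Ki = subfield_chain[of i]
  have fK: "(branch * h) $ n $ m \<in> K i" for n m using i by (simp add: fps2_over_def)
  have "escaping $ N \<in> K i \<and> (\<forall>n. h $ n $ N \<in> K i)" for N
  proof (induction N rule: less_induct)
    case (less N)
    show ?case
    proof (cases "N = 0")
      case True
      have "h $ n $ 0 = (branch * h) $ Suc n $ 0" for n by (simp add: branch_mult_nth escaping_nth)
      then show ?thesis using True fK subfield_setD(2)[OF Ki] by (simp add: escaping_nth)
    next
      case False
      define S where "S n = (\<Sum>j\<in>{1..<N}. escaping $ j * h $ n $ (N - j))" for n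
      have S: "S n \<in> K i" for n
        unfolding S_def by (intro subfield_set_sum[OF Ki] subfield_setD(6)[OF Ki]) (use less False in auto)
      have conv: "(escaping * h $ n) $ N = escaping $ N * h $ n $ 0 + S n" for n
      proof -
        have "{0..N} = insert 0 (insert N {1..<N})" using False by auto
        then show ?thesis using False by (simp add: fps_mult_nth S_def escaping_nth)
      qed
      have h0: "h $ n $ 0 \<in> K i" for n using less[of 0] False by simp
      \<comment> \<open>The coefficient of \<open>x\<^sup>N\<close> in \<open>c h\<^sub>0 = - f\<^sub>0\<close>, solved for the coefficient of \<open>c\<close>.\<close>
      have "- ((branch * h) $ 0 $ N) - S 0 = escaping $ N * h $ 0 $ 0"
        by (simp only: branch_mult_nth fps_neg_nth conv minus_minus add_diff_cancel_right')
      then have cN_eq: "escaping $ N = (- ((branch * h) $ 0 $ N) - S 0) / h $ 0 $ 0"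
        using nonzero_mult_div_cancel_right[OF h00, of "escaping $ N"] by (simp only:)
      have cN: "escaping $ N \<in> K i" unfolding cN_eq by (intro subfield_setD[OF Ki] fK S h0)
      have hN_eq: "h $ n $ N = (branch * h) $ Suc n $ N + (escaping $ N * h $ Suc n $ 0 + S (Suc n))" for n
        by (simp add: branch_mult_nth conv)
      have "h $ n $ N \<in> K i" for n unfolding hN_eq by (intro subfield_setD[OF Ki] fK S h0 cN)
      then show ?thesis using cN by blast
    qed
  qed
  then have "escaping $ Suc i \<in> K (Suc i)" using monoD[OF mono_chain, of i "Suc i"] by auto
  then show False using escaping_nth by blast
qed

text \<open>
  The sequence that violates quasi-completeness: each of these ideals contains approximations of the
  branch to a high order, whereas the elements of their intersection have no linear terms.
\<close>
definition near_branch :: "nat \<Rightarrow> 'k fps2 set" where "near_branch n = {f\<in>chain_series. \<exists>h. f - branch * h \<in> vanishing n}"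

lemma ideal_near_branch: "ideal (near_branch n) chain_ring"
  unfolding ideal_record_iff
proof (intro conjI ballI)
  show "near_branch n \<subseteq> chain_series" by (auto simp: near_branch_def)
  have "0 - branch * 0 \<in> vanishing n" by (simp add: vanishing_closed)
  then show "0 \<in> near_branch n" using zero_mem unfolding near_branch_def by blast
  fix a r assume a: "a \<in> near_branch n"
  then obtain h where h: "a \<in> chain_series" "a - branch * h \<in> vanishing n" unfolding near_branch_def by blast
  {
    assume "r \<in> near_branch n"
    then obtain g where g: "r \<in> chain_series" "r - branch * g \<in> vanishing n" unfolding near_branch_def by blast
    have eq: "(a - r) - branch * (h - g) = (a - branch * h) - (r - branch * g)" by (simp add: algebra_simps)
    have "(a - r) - branch * (h - g) \<in> vanishing n" unfolding eq by (rule vanishing_closed(3)[OF h(2) g(2)])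
    then show "a - r \<in> near_branch n" using h g diff_mem unfolding near_branch_def by blast
  }
  assume r: "r \<in> chain_series"
  have eq: "r * a - branch * (r * h) = r * (a - branch * h)" by (simp add: algebra_simps)
  have "r * a - branch * (r * h) \<in> vanishing n" unfolding eq by (rule vanishing_mult[OF h(2)])
  then show "r * a \<in> near_branch n" using h r mult_mem unfolding near_branch_def by blast
qed

text \<open>
  Principal ideals of \<open>k[[x,y]]\<close> are closed, so an element of the intersection is a multiple of the
  branch. Since the cofactor is not a unit, the product has no terms of degree below two.
\<close>
lemma Inter_near_branch: "(\<Inter>n. near_branch n) \<subseteq> vanishing (triangle 2)"
proof
  fix f assume "f \<in> (\<Inter>n. near_branch n)"
  then have fR: "f \<in> chain_series" and f: "\<exists>h. f - branch * h \<in> vanishing n" for n unfolding near_branch_def by blast+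
  obtain h where "f = (\<Sum>i<1::nat. branch * h i)"
  proof (rule linear_equation_limit[OF subfield_set_UNIV, of f "\<lambda>_. branch" 1])
    fix j
    obtain h where "f - branch * h \<in> vanishing j" using f by blast
    then show "\<exists>h. (\<forall>i. h i \<in> fps2_over UNIV) \<and> f - (\<Sum>i<1::nat. branch * h i) \<in> vanishing j"
      by (intro exI[of _ "\<lambda>_. h"]) (simp add: fps2_over_def)
  qed blast
  then have fu: "f = branch * h 0" by simp
  have h0: "h 0 $ 0 $ 0 = 0" using cofactor_of_branch_not_unit fR fu by blast
  have "f $ n $ m = 0" if "n + m < 2" for n m
  proof -
    have "(n, m) \<in> {(0, 0), (0, 1), (1, 0)}" using that by (cases n; cases m) auto
    then show ?thesis by (auto simp: fu branch_nth fps_mult_nth escaping_nth h0)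
  qed
  then show "f \<in> vanishing (triangle 2)" unfolding vanishing_triangle by blast
qed

text \<open>
  The witness is \<open>y\<close> minus a truncation of \<open>c\<close>. It lies in the ring since only finitely many
  coefficients of \<open>c\<close> are involved.
\<close>
lemma linear_form_in_near_branch:
  obtains a where "a \<in> near_branch s" "a $ 1 $ 0 = 1"
proof -
  define a where "a = term2 1 1 0 - (\<Sum>m<s. term2 (escaping $ m) 0 m)"
  have sum_nth: "(\<Sum>m<s. term2 (escaping $ m) 0 m) $ n $ k = (if n = 0 \<and> k < s then escaping $ k else 0)" for n k
    by (auto simp: fps_sum_nth term2_nth)
  have "(\<Sum>m<s. term2 (escaping $ m) 0 m) \<in> chain_series"
    by (induction s) (auto simp: zero_mem add_mem term2_mem)
  then have "a \<in> chain_series" unfolding a_def by (intro diff_mem term2_mem)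
  moreover have "a - branch * 1 \<in> vanishing s"
    unfolding vanishing_def
  proof (intro CollectI allI impI)
    fix n k assume "prod_encode (n, k) < s"
    then have "k < s" using le_prod_encode_2[of k n] by linarith
    then show "(a - branch * 1) $ n $ k = 0"
      by (auto simp: a_def branch_def sum_nth term2_nth)
  qed
  ultimately have "a \<in> near_branch s" unfolding near_branch_def by blast
  moreover have "a $ 1 $ 0 = 1" by (simp add: a_def sum_nth term2_nth)
  ultimately show thesis by (rule that)
qed

lemma not_quasi_complete_chain_ring: "\<not> quasi_complete chain_ring max_ideal"
proof
  assume qc: "quasi_complete chain_ring max_ideal"
  have "decseq near_branch" unfolding decseq_def near_branch_def using vanishing_antimono by blast
  then obtain s where s: "near_branch s \<subseteq> (\<Inter>n. near_branch n) <+>\<^bsub>chain_ring\<^esub> ideal_power chain_ring max_ideal 2"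
    using qc ideal_near_branch unfolding quasi_complete_def by blast
  obtain a where a: "a \<in> near_branch s" "a $ 1 $ 0 = 1" by (rule linear_form_in_near_branch)
  then obtain p q where p: "p \<in> (\<Inter>n. near_branch n)" and q: "q \<in> ideal_power chain_ring max_ideal 2" and pq: "a = p + q"
    using s unfolding set_add_def' by auto
  have "q \<in> vanishing (triangle 2)" using q unfolding ideal_power_eq by blast
  then have "a \<in> vanishing (triangle 2)" unfolding pq by (rule vanishing_closed(2)[OF subsetD[OF Inter_near_branch p]])
  then have "a $ 1 $ 0 = 0" unfolding vanishing_triangle by simp
  then show False using a by simp
qed

end

section \<open>Transport along ring isomorphisms\<close>

lemma ideal_image_iso:
  assumes "ring A" "ring B" "e \<in> ring_iso A B" "ideal I A"
  shows "ideal (e ` I) B"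
proof -
  interpret ring_hom_ring A B e
    using assms(1-3) by (intro ring_hom_ring.intro ring_hom_ring_axioms.intro) (auto simp: ring_iso_def)
  interpret I: ideal I A by fact
  have surj: "e ` carrier A = carrier B" using ring_iso_memE(5)[OF assms(3)] by (simp add: bij_betw_def)
  show ?thesis
  proof (rule idealI[OF assms(2)])
    show "subgroup (e ` I) (add_monoid B)" by (rule img_is_add_subgroup) (rule I.a_subgroup)
  next
    fix y x assume "y \<in> e ` I" "x \<in> carrier B"
    then obtain a r where ar: "y = e a" "a \<in> I" "x = e r" "r \<in> carrier A" using surj by blast
    have "a \<in> carrier A" by (rule I.Icarr[OF ar(2)])
    then have eq: "x \<otimes>\<^bsub>B\<^esub> y = e (r \<otimes>\<^bsub>A\<^esub> a)" "y \<otimes>\<^bsub>B\<^esub> x = e (a \<otimes>\<^bsub>A\<^esub> r)" using ar by simp_all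
    show "x \<otimes>\<^bsub>B\<^esub> y \<in> e ` I" "y \<otimes>\<^bsub>B\<^esub> x \<in> e ` I"
      unfolding eq by (intro imageI I.I_l_closed I.I_r_closed ar)+
  qed
qed

locale ring_isomorphism = A: ring A + B: ring B for A :: "('a, 'c) ring_scheme" and B :: "('b, 'd) ring_scheme" and e +
  assumes iso: "e \<in> ring_iso A B"
begin

definition inv_e where "inv_e = inv_into (carrier A) e"

lemma bij: "bij_betw e (carrier A) (carrier B)" by (rule ring_iso_memE(5)[OF iso])

lemma iso_inv_e: "inv_e \<in> ring_iso B A" unfolding inv_e_def by (rule ring_iso_set_sym[OF A.ring_axioms iso])

lemma inv_e_e: "x \<in> carrier A \<Longrightarrow> inv_e (e x) = x" unfolding inv_e_def using bij by (simp add: bij_betw_def)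

lemma e_inv_e: "y \<in> carrier B \<Longrightarrow> e (inv_e y) = y" unfolding inv_e_def using bij by (simp add: bij_betw_def f_inv_into_f)

lemma image_inv_e_e: "I \<subseteq> carrier A \<Longrightarrow> inv_e ` e ` I = I" using inv_e_e by (force simp: image_image)

lemma image_e_inv_e: "J \<subseteq> carrier B \<Longrightarrow> e ` inv_e ` J = J" using e_inv_e by (force simp: image_image)

lemma ideal_image: "ideal I A \<Longrightarrow> ideal (e ` I) B" by (rule ideal_image_iso[OF A.ring_axioms B.ring_axioms iso])

lemma ideal_image_inv_e: "ideal J B \<Longrightarrow> ideal (inv_e ` J) A" by (rule ideal_image_iso[OF B.ring_axioms A.ring_axioms iso_inv_e])

lemma ideal_subset: "ideal I A \<Longrightarrow> I \<subseteq> carrier A" "ideal J B \<Longrightarrow> J \<subseteq> carrier B"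
  by (auto dest: ideal.Icarr)

lemma zero_image: "e \<zero>\<^bsub>A\<^esub> = \<zero>\<^bsub>B\<^esub>"
  using ring_hom_zero[of e A B] iso A.ring_axioms B.ring_axioms by (simp add: ring_iso_def)

lemma ideal_prod_image:
  assumes "ideal I A" "ideal J A"
  shows "e ` ideal_prod A I J = ideal_prod B (e ` I) (e ` J)"
proof
  note IJ = ideal_subset(1)[OF assms(1)] ideal_subset(1)[OF assms(2)]
  show "e ` ideal_prod A I J \<subseteq> ideal_prod B (e ` I) (e ` J)"
  proof
    fix y assume "y \<in> e ` ideal_prod A I J"
    then obtain x where x: "x \<in> ideal_prod A I J" and y: "y = e x" by blast
    from x have "e x \<in> ideal_prod B (e ` I) (e ` J)"
    proof (induction rule: ideal_prod.induct)
      case (prod i j)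
      then have "e (i \<otimes>\<^bsub>A\<^esub> j) = e i \<otimes>\<^bsub>B\<^esub> e j" using IJ ring_iso_memE(2)[OF iso] by blast
      then show ?case using ideal_prod.prod[of "e i" "e ` I" "e j" "e ` J" B] prod by simp
    next
      case (sum a b)
      have "e (a \<oplus>\<^bsub>A\<^esub> b) = e a \<oplus>\<^bsub>B\<^esub> e b"
        using sum(1,2) A.ideal_prod_in_carrier[OF assms] ring_iso_memE(3)[OF iso] by blast
      then show ?case using ideal_prod.sum[OF sum(3,4)] by simp
    qed
    then show "y \<in> ideal_prod B (e ` I) (e ` J)" unfolding y .
  qed
  show "ideal_prod B (e ` I) (e ` J) \<subseteq> e ` ideal_prod A I J"
  proof
    fix y assume "y \<in> ideal_prod B (e ` I) (e ` J)"
    then show "y \<in> e ` ideal_prod A I J"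
    proof (induction rule: ideal_prod.induct)
      case (prod u v)
      then obtain i j where ij: "u = e i" "i \<in> I" "v = e j" "j \<in> J" by blast
      have "i \<in> carrier A" "j \<in> carrier A" using ij IJ by blast+
      then have "u \<otimes>\<^bsub>B\<^esub> v = e (i \<otimes>\<^bsub>A\<^esub> j)" using ij ring_iso_memE(2)[OF iso] by simp
      then show ?case using ideal_prod.prod[OF ij(2,4)] by blast
    next
      case (sum u v)
      then obtain a b where ab: "u = e a" "a \<in> ideal_prod A I J" "v = e b" "b \<in> ideal_prod A I J" by blast
      have "a \<in> carrier A" "b \<in> carrier A" using ab A.ideal_prod_in_carrier[OF assms] by blast+
      then have "u \<oplus>\<^bsub>B\<^esub> v = e (a \<oplus>\<^bsub>A\<^esub> b)" using ab ring_iso_memE(3)[OF iso] by simp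
      then show ?case using ideal_prod.sum[OF ab(2,4)] by blast
    qed
  qed
qed

lemma ideal_power_image:
  assumes "ideal I A"
  shows "ideal (ideal_power A I k) A \<and> e ` ideal_power A I k = ideal_power B (e ` I) k"
proof (induction k)
  case 0
  then show ?case using bij A.oneideal by (simp add: ideals_set_def bij_betw_def)
next
  case (Suc k)
  have "ideal_power A I (Suc k) = ideal_prod A (ideal_power A I k) I"
    "ideal_power B (e ` I) (Suc k) = ideal_prod B (ideal_power B (e ` I) k) (e ` I)"
    by (simp_all add: ideals_set_def)
  then show ?case using Suc ideal_prod_image[OF _ assms] A.ideal_prod_is_ideal[OF _ assms] by metis
qed

lemma weakly_quasi_complete_image:
  assumes "weakly_quasi_complete A \<mm>" "ideal \<mm> A" shows "weakly_quasi_complete B (e ` \<mm>)"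
  unfolding weakly_quasi_complete_def
proof (intro allI impI)
  fix J :: "nat \<Rightarrow> 'b set" and k
  assume J: "\<forall>n. ideal (J n) B" "decseq J" "(\<Inter>n. J n) = {\<zero>\<^bsub>B\<^esub>}"
  have JB: "J n \<subseteq> carrier B" for n using J(1) ideal_subset(2) by blast
  have id: "ideal (inv_e ` J n) A" for n using J(1) ideal_image_inv_e by blast
  have "(\<Inter>n. inv_e ` J n) = {\<zero>\<^bsub>A\<^esub>}"
  proof
    show "{\<zero>\<^bsub>A\<^esub>} \<subseteq> (\<Inter>n. inv_e ` J n)"
      using id by (auto intro: additive_subgroup.zero_closed ideal.axioms(1))
    show "(\<Inter>n. inv_e ` J n) \<subseteq> {\<zero>\<^bsub>A\<^esub>}"
    proof
      fix x assume x: "x \<in> (\<Inter>n. inv_e ` J n)"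
      have "e x \<in> J n" for n
      proof -
        obtain y where "y \<in> J n" "x = inv_e y" using x by blast
        moreover from this have "e (inv_e y) = y" using JB by (intro e_inv_e) blast
        ultimately show ?thesis by simp
      qed
      then have "e x = \<zero>\<^bsub>B\<^esub>" using J(3) by blast
      moreover have "x \<in> carrier A" using x ideal_subset(1)[OF id[of 0]] by blast
      ultimately have "x = \<zero>\<^bsub>A\<^esub>" using inv_e_e[of x] inv_e_e[of "\<zero>\<^bsub>A\<^esub>"] zero_image by simp
      then show "x \<in> {\<zero>\<^bsub>A\<^esub>}" by simp
    qed
  qed
  moreover have "decseq (\<lambda>n. inv_e ` J n)" using J(2) unfolding decseq_def by blast
  ultimately obtain s where "inv_e ` J s \<subseteq> ideal_power A \<mm> k"
    using assms(1)[unfolded weakly_quasi_complete_def, rule_format, of "\<lambda>n. inv_e ` J n" k] id by blast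
  then have "e ` inv_e ` J s \<subseteq> e ` ideal_power A \<mm> k" by blast
  then have "J s \<subseteq> ideal_power B (e ` \<mm>) k"
    using image_e_inv_e[OF JB] ideal_power_image[OF assms(2)] by simp
  then show "\<exists>s. J s \<subseteq> ideal_power B (e ` \<mm>) k" ..
qed

lemma quasi_complete_preimage:
  assumes qc: "quasi_complete B (e ` \<mm>)" and m: "ideal \<mm> A" shows "quasi_complete A \<mm>"
  unfolding quasi_complete_def
proof (intro allI impI)
  fix I :: "nat \<Rightarrow> 'a set" and k
  assume I: "\<forall>n. ideal (I n) A" "decseq I"
  have IA: "I n \<subseteq> carrier A" for n using I(1) ideal_subset(1) by blast
  have "ideal (e ` I n) B" for n using I(1) ideal_image by blast
  moreover have "decseq (\<lambda>n. e ` I n)" using I(2) unfolding decseq_def by blast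
  ultimately obtain s where s: "e ` I s \<subseteq> (\<Inter>n. e ` I n) <+>\<^bsub>B\<^esub> ideal_power B (e ` \<mm>) k"
    using qc[unfolded quasi_complete_def, rule_format, of "\<lambda>n. e ` I n" k] by blast
  have "I s \<subseteq> (\<Inter>n. I n) <+>\<^bsub>A\<^esub> ideal_power A \<mm> k"
  proof
    fix x assume x: "x \<in> I s"
    have "e x \<in> (\<Inter>n. e ` I n) <+>\<^bsub>B\<^esub> e ` ideal_power A \<mm> k"
      using subsetD[OF s imageI[OF x]] ideal_power_image[OF m, of k] by simp
    then obtain p q where p: "p \<in> (\<Inter>n. e ` I n)" and q: "q \<in> e ` ideal_power A \<mm> k" and epq: "e x = p \<oplus>\<^bsub>B\<^esub> q"
      unfolding set_add_def' by blast
    obtain b where b: "b \<in> ideal_power A \<mm> k" "q = e b" using q by blast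
    have bA: "b \<in> carrier A" using b ideal_power_image[OF m] ideal_subset(1) by blast
    obtain a where a: "a \<in> carrier A" "p = e a" using p IA by blast
    have "a \<in> I n" for n
    proof -
      obtain a' where "a' \<in> I n" "p = e a'" using p by blast
      moreover from this have "a = a'" using a inv_e_e[of a] inv_e_e[of a'] IA by (metis subsetD)
      ultimately show ?thesis by simp
    qed
    moreover have "e x = e (a \<oplus>\<^bsub>A\<^esub> b)" using epq a b bA ring_iso_memE(3)[OF iso] by simp
    then have "x = a \<oplus>\<^bsub>A\<^esub> b" using inv_e_e[of x] inv_e_e[of "a \<oplus>\<^bsub>A\<^esub> b"] x IA a bA A.add.m_closed by auto
    ultimately show "x \<in> (\<Inter>n. I n) <+>\<^bsub>A\<^esub> ideal_power A \<mm> k"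
      using b unfolding set_add_def' by blast
  qed
  then show "\<exists>s. I s \<subseteq> (\<Inter>n. I n) <+>\<^bsub>A\<^esub> ideal_power A \<mm> k" ..
qed

lemma maximalideal_image:
  assumes "maximalideal \<mm> A" shows "maximalideal (e ` \<mm>) B"
proof -
  interpret M: maximalideal \<mm> A by fact
  have mA: "\<mm> \<subseteq> carrier A" by (rule M.a_subset)
  show ?thesis
  proof (rule maximalidealI)
    show "ideal (e ` \<mm>) B" by (rule ideal_image[OF M.ideal_axioms])
    show "carrier B \<noteq> e ` \<mm>"
      using M.I_notcarr image_inv_e_e[OF mA] image_inv_e_e[OF order_refl] bij by (metis bij_betw_def)
    fix J assume J: "ideal J B" "e ` \<mm> \<subseteq> J" "J \<subseteq> carrier B"
    have "\<mm> \<subseteq> inv_e ` J" using image_mono[OF J(2), of inv_e] image_inv_e_e[OF mA] by simp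
    then have "inv_e ` J = \<mm> \<or> inv_e ` J = carrier A"
      using M.I_maximal[OF ideal_image_inv_e[OF J(1)]] ideal_subset(1)[OF ideal_image_inv_e[OF J(1)]] by blast
    then show "J = e ` \<mm> \<or> J = carrier B" using image_e_inv_e[OF J(3)] bij by (metis bij_betw_def)
  qed
qed

end

lemma (in ring_isomorphism) inverse_isomorphism: "ring_isomorphism B A inv_e"
  using iso_inv_e by (intro ring_isomorphism.intro ring_isomorphism_axioms.intro A.ring_axioms B.ring_axioms)

lemma (in ring_isomorphism) noetherian_local_ring_image:
  assumes "noetherian_local_ring A \<mm>" "cring B" shows "noetherian_local_ring B (e ` \<mm>)"
proof -
  interpret N: noetherian_local_ring A \<mm> by fact
  show ?thesis
  proof (intro noetherian_local_ring.intro noetherian_local_ring_axioms.intro assms(2))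
    show "noetherian_ring B"
    proof (rule B.noetherian_ringI)
      fix J assume J: "ideal J B"
      obtain S where S: "S \<subseteq> carrier A" "finite S" "inv_e ` J = Idl\<^bsub>A\<^esub> S"
        using N.finetely_gen[OF ideal_image_inv_e[OF J]] by blast
      have SB: "e ` S \<subseteq> carrier B" using S(1) bij by (auto simp: bij_betw_def)
      have J_eq: "J = e ` inv_e ` J" using image_e_inv_e[OF ideal_subset(2)[OF J]] by simp
      have gen: "ideal (Idl\<^bsub>B\<^esub> (e ` S)) B" by (rule B.genideal_ideal[OF SB])
      have "S \<subseteq> inv_e ` J" unfolding S(3) by (rule A.genideal_self[OF S(1)])
      then have "Idl\<^bsub>B\<^esub> (e ` S) \<subseteq> J" using J_eq by (intro B.genideal_minimal[OF J]) blast
      moreover have "S \<subseteq> inv_e ` (Idl\<^bsub>B\<^esub> (e ` S))"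
        using image_mono[OF B.genideal_self[OF SB], of inv_e] image_inv_e_e[OF S(1)] by simp
      then have "inv_e ` J \<subseteq> inv_e ` (Idl\<^bsub>B\<^esub> (e ` S))"
        unfolding S(3) by (rule A.genideal_minimal[OF ideal_image_inv_e[OF gen]])
      then have "J \<subseteq> Idl\<^bsub>B\<^esub> (e ` S)" using J_eq image_e_inv_e[OF ideal_subset(2)[OF gen]] by (metis image_mono)
      ultimately show "\<exists>A\<subseteq>carrier B. finite A \<and> J = Idl\<^bsub>B\<^esub> A" using SB S(2) by blast
    qed
    show "maximalideal (e ` \<mm>) B" by (rule maximalideal_image[OF N.maximal])
    fix J assume J: "maximalideal J B"
    have "inv_e ` J = \<mm>" using ring_isomorphism.maximalideal_image[OF inverse_isomorphism J] N.maximal_unique by blast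
    moreover have "J \<subseteq> carrier B" using ideal_subset(2) J maximalideal.axioms(1) by blast
    ultimately show "J = e ` \<mm>" using image_e_inv_e by metis
  qed
qed

section \<open>A weakly quasi-complete ring that is not quasi-complete\<close>

text \<open>
  A series over a countable field is encoded as the graph of its coefficient function, a set of natural
  numbers. This makes the ring isomorphic to one whose elements are sets of natural numbers.
\<close>
theorem theorem3p3:
  shows "\<exists>(R :: nat set ring) \<mm>. noetherian_local_ring R \<mm> \<and>
           weakly_quasi_complete R \<mm> \<and> \<not> quasi_complete R \<mm>"
proof -
  interpret chain: square_subfield_chain even_chain by (rule square_subfield_chain_even_chain)
  obtain d :: "f2_poly fract \<Rightarrow> nat" where d: "inj d" using countable_fract unfolding countable_def by blast
  define e :: "f2_poly fract fps2 \<Rightarrow> nat set"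
    where "e f = range (\<lambda>(n, m). to_nat (n, m, d (f $ n $ m)))" for f
  have inj: "inj e"
  proof (rule injI, intro fps_ext)
    fix f g n m assume "e f = e g"
    then have "to_nat (n, m, d (f $ n $ m)) \<in> e g" unfolding e_def by force
    then have "d (f $ n $ m) = d (g $ n $ m)" unfolding e_def by auto
    then show "f $ n $ m = g $ n $ m" using d by (simp add: inj_eq)
  qed
  then have inj': "inj_on e (carrier chain.chain_ring)" by (rule inj_on_subset) simp
  let ?B = "image_ring e chain.chain_ring"
  have iso: "e \<in> ring_iso chain.chain_ring ?B" by (rule inj_imp_image_ring_iso[OF inj'])
  have "cring ?B"
    using chain.R.ring_iso_imp_img_cring[OF iso] by (simp add: image_ring_def image_group_def monoid.defs)
  then interpret B: cring ?B .
  interpret ring_isomorphism chain.chain_ring ?B e by unfold_locales (rule iso)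
  show ?thesis
    using noetherian_local_ring_image[OF chain.noetherian_local_chain_ring B.is_cring]
      weakly_quasi_complete_image[OF chain.weakly_quasi_complete_chain_ring chain.ideal_max_ideal]
      quasi_complete_preimage[OF _ chain.ideal_max_ideal] chain.not_quasi_complete_chain_ring
    by blast
qed

end
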